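(* Let $0<\delta<1$, $0<\epsilon<1$, $\lambda>0$, and assume (LipS), (SmS* ) and (SCS* ). Let $x^{(k)}\in\mathcal D\cap\mathcal X$, draw $\mathcal S$ with $|\mathcal S|\ge16(K^* )^2\ln(2p/\delta)/((\gamma^* )^2\epsilon^2)$, let $\hat H(x^{(k)})=\mathcal P(\lambda;H(x^{(k)}))$, and let $x^{(k+1)}$ be given by the update with $\mathbf g=\nabla F(x^{(k)})$, $M=\hat H(x^{(k)})$, $\alpha_k=1$. If $\lambda\ge(1-\epsilon)\gamma^*$, then with probability $1-\delta$, $$\|x^{(k+1)}-x^*\|\le\rho_0\|x^{(k)}-x^*\|+\xi\|x^{(k)}-x^*\|^2,\qquad \rho_0=\frac{\lambda-(1-\epsilon)\gamma^*+\gamma^*\epsilon}{\lambda},\quad\xi=\frac{(\sqrt p+1/2)L}{\lambda}.$$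
   Context: $f_1,\dots,f_n$ are twice differentiable real functions with domains $\mathrm{dom}(f_i)\subseteq\mathbb R^p$; $\mathcal D=\bigcap_i\mathrm{dom}(f_i)$ is open and convex, $\mathcal X\subseteq\mathbb R^p$ is convex, $F=\frac1n\sum_{i=1}^n f_i$, and $x^*$ is a local minimum of $F$ over $\mathcal D\cap\mathcal X$. $\|\cdot\|$ is the Euclidean/spectral norm and $\lambda_{\min}$ the usual smallest eigenvalue. (LipS): there is $L>0$ with $\|\nabla^2f_i(x)-\nabla^2f_i(x^* )\|\le L\|x-x^*\|$ for all $x\in\mathcal D\cap\mathcal X$ and all $i$. (SmS* ): $K^*:=\max_i\|\nabla^2 f_i(x^* )\|<\infty$. (SCS* ): $\gamma^*:=\lambda_{\min}(\nabla^2F(x^* ))>0$. Sub-sampled Hessian: for a collection $\mathcal S$ of indices drawn uniformly at random from $\{1,\dots,n\}$, $H(x)=\frac1{|\mathcal S|}\sum_{j\in\mathcal S}\nabla^2f_j(x)$. Spectral regularization: for symmetric $H=\sum_i\lambda_i(H)v_iv_i^T$, $\mathcal P(\lambda;H)=\sum_{i=1}^p\max\{\lambda_i(H),\lambda\}v_iv_i^T$. Update: $x^{(k+1)}=\arg\min_{x\in\mathcal D\cap\mathcal X}\{F(x^{(k)})+(x-x^{(k)})^T\mathbf g+\frac1{2\alpha_k}(x-x^{(k)})^TM(x-x^{(k)})\}$. *)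

theory Defs
  imports "HOL-Analysis.Analysis" "HOL-Probability.Probability"
begin

definition spec_norm :: "real^'p^'p \<Rightarrow> real" where
  "spec_norm A = onorm (\<lambda>x. A *v x)"

definition eigvals :: "real^'p^'p \<Rightarrow> real set" where
  "eigvals A = {\<mu>. \<exists>v. v \<noteq> 0 \<and> A *v v = \<mu> *\<^sub>R v}"

definition lambda_min :: "real^'p^'p \<Rightarrow> real" where
  "lambda_min A = Min (eigvals A)"

text \<open>Spectral regularization P(lam; H) = sum_i max(lambda_i(H), lam) v_i v_i^T
  for symmetric H: the matrix acting on every eigenvector v of H with eigenvalue mu
  as multiplication by max mu lam (well defined by the spectral theorem).\<close>
definition spec_reg :: "real \<Rightarrow> real^'p^'p \<Rightarrow> real^'p^'p" where
  "spec_reg lam H = (THE M. \<forall>v \<mu>. H *v v = \<mu> *\<^sub>R v \<longrightarrow> M *v v = max \<mu> lam *\<^sub>R v)"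

definition sample_pmf :: "nat \<Rightarrow> nat \<Rightarrow> (nat \<Rightarrow> nat) pmf" where
  "sample_pmf m n = Pi_pmf {..<m} 0 (\<lambda>_. pmf_of_set {..<n})"

definition subH :: "(nat \<Rightarrow> real^'p \<Rightarrow> real^'p^'p) \<Rightarrow> nat \<Rightarrow> (nat \<Rightarrow> nat) \<Rightarrow> real^'p \<Rightarrow> real^'p^'p" where
  "subH hess m S x = (1 / real m) *\<^sub>R (\<Sum>j<m. hess (S j) x)"

end

theory Submission
  imports Defs
begin

text \<open>
  Write \<open>e = y - xstar\<close>, \<open>\<Delta> = xk - xstar\<close> and let \<open>M\<close>, \<open>Ms\<close> be the spectral regularizations of the
  sub-sampled Hessians \<open>H\<close>, \<open>Hs\<close> at \<open>xk\<close> and \<open>xstar\<close>. Testing the minimality of \<open>y\<close> in the direction of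
  \<open>xstar\<close> and conversely gives \<open>lam * norm e \<le> norm (M *v \<Delta> - (gradF xk - gradF xstar))\<close>. The right-hand
  side is split along \<open>M\<close>, \<open>Ms\<close>, \<open>Hs\<close> and the Hessian of \<open>F\<close> at \<open>xstar\<close>. The first difference costs
  \<open>sqrt p * L * norm \<Delta>\<close>, since spectral regularization is nonexpansive in the Frobenius norm; the second
  costs \<open>lam - (1 - \<epsilon>) * \<gamma>\<close>; the third costs \<open>\<epsilon> * \<gamma>\<close> on the event that \<open>Hs\<close> deviates from its mean by at
  most that much; linearizing the gradient at \<open>xstar\<close> costs \<open>L / 2 * (norm \<Delta>)\<^sup>2\<close>.

  The event has probability at least \<open>1 - \<delta>\<close> by a matrix Hoeffding inequality. It follows from the method
  of exchangeable pairs (Mackey, Jordan, Chen, Farrell, Tropp): the derivative of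
  \<open>\<Phi> \<theta> = E (tr (cosh (\<theta> Y)))\<close> is at most a constant times \<open>\<theta> * \<Phi> \<theta>\<close>. This avoids the Golden-Thompson
  and Lieb trace inequalities.
\<close>

section \<open>Spectral theorem for real symmetric matrices\<close>

definition orthonormal :: "('n::finite \<Rightarrow> real^'n) \<Rightarrow> bool" where
  "orthonormal v \<longleftrightarrow> (\<forall>i j. v i \<bullet> v j = (if i = j then 1 else 0))"

text \<open>The family is indexed by the coordinate type, so independence and a dimension count give
  spanning; pairing with \<open>v i\<close> then identifies the coefficients.\<close>

lemma orthonormal_expand:
  fixes v :: "'n::finite \<Rightarrow> real^'n"
  assumes "orthonormal v"
  shows "x = (\<Sum>i\<in>UNIV. (v i \<bullet> x) *\<^sub>R v i)"
proof -
  have vv: "v i \<bullet> v j = (if i = j then 1 else 0)" for i j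
    using assms by (simp add: orthonormal_def)
  have inj: "inj v"
    by (rule injI) (metis vv zero_neq_one)
  have "independent (range v)"
  proof (rule pairwise_orthogonal_independent)
    show "pairwise orthogonal (range v)"
      using vv by (auto simp: pairwise_def orthogonal_def)
    show "0 \<notin> range v"
      using vv by (metis imageE inner_zero_left zero_neq_one)
  qed
  moreover have "card (range v) = DIM(real^'n)"
    using inj by (simp add: card_image)
  ultimately have "span (range v) = UNIV"
    by (metis card_eq_dim dim_UNIV UNIV_I span_UNIV subset_UNIV top.extremum_uniqueI finite_class.finite_UNIV finite_imageI)
  then have "x \<in> span (range v)" by simp
  then obtain c where "x = (\<Sum>y\<in>range v. c y *\<^sub>R y)"
    by (auto simp: span_finite)
  then have x: "x = (\<Sum>i\<in>UNIV. c (v i) *\<^sub>R v i)"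
    using inj by (simp add: sum.reindex)
  have "v i \<bullet> x = c (v i)" for i
    by (subst x) (simp add: inner_sum_right vv if_distrib cong: if_cong)
  then show ?thesis using x by simp
qed

lemma orthonormal_inner:
  assumes "orthonormal v"
  shows "x \<bullet> y = (\<Sum>i\<in>UNIV. (v i \<bullet> x) * (v i \<bullet> y))"
  by (subst (1) orthonormal_expand[OF assms, of x]) (simp add: inner_sum_left)

lemma orthonormal_norm:
  assumes "orthonormal v"
  shows "(norm x)\<^sup>2 = (\<Sum>i\<in>UNIV. (v i \<bullet> x)\<^sup>2)"
  unfolding power2_norm_eq_inner orthonormal_inner[OF assms, of x x] by (simp only: power2_eq_square)

lemma symmetric_matrix_inner:
  fixes A :: "real^'n^'n"
  assumes "transpose A = A"
  shows "x \<bullet> (A *v y) = (A *v x) \<bullet> y"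
  by (metis assms dot_lmul_matrix transpose_matrix_vector)

lemma transpose_sum: "transpose (sum g S) = (\<Sum>i\<in>S. transpose (g i))"
  for g :: "'i \<Rightarrow> real^'n^'m"
  by (simp add: transpose_def vec_eq_iff)

lemma matrix_vector_mult_sum_right: "A *v sum g S = (\<Sum>i\<in>S. A *v g i)"
  for A :: "real^'n^'m"
  by (rule linear_sum[OF matrix_vector_mul_linear])

text \<open>First-order condition at a maximum: for small \<open>t\<close> the linear term
  dominates, so its coefficient must vanish.\<close>

lemma zero_if_quadratic_nonpos:
  fixes c d :: real
  assumes "\<And>t. 2 * t * c + t\<^sup>2 * d \<le> 0"
  shows "c = 0"
proof (rule ccontr)
  assume c: "c \<noteq> 0"
  have d: "d \<le> 0" using assms[of 1] assms[of "-1"] by simp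
  \<comment> \<open>The witness \<open>t = c / (1 - d)\<close> is well defined since
    \<open>d \<le> 0\<close>, and it makes the expression equal to the positive number computed
    next.\<close>
  have "2 * (c / (1 - d)) * c + (c / (1 - d))\<^sup>2 * d \<le> 0" by (rule assms)
  moreover have "2 * (c / (1 - d)) * c + (c / (1 - d))\<^sup>2 * d = c\<^sup>2 * (2 - d) / (1 - d)\<^sup>2"
    using d by (simp add: divide_simps) (auto simp: algebra_simps power2_eq_square)
  moreover have "c\<^sup>2 * (2 - d) / (1 - d)\<^sup>2 > 0"
    using c d by auto
  ultimately show False by simp
qed

text \<open>The orthogonal complement of a set of eigenvectors is invariant under a symmetric
  matrix, and a maximizer of the Rayleigh quotient on its unit sphere is an eigenvector.\<close>

lemma eigenvector_in_complement:
  fixes A :: "real^'n^'n"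
  assumes sym: "transpose A = A" and card: "card B < CARD('n)" and fin: "finite B"
    and eig: "\<And>b. b \<in> B \<Longrightarrow> \<exists>\<mu>. A *v b = \<mu> *\<^sub>R b"
  shows "\<exists>v \<mu>. norm v = 1 \<and> (\<forall>b\<in>B. b \<bullet> v = 0) \<and> A *v v = \<mu> *\<^sub>R v"
proof -
  define W where "W = {x. \<forall>b\<in>B. b \<bullet> x = 0}"
  have W_add: "x + y \<in> W" if "x \<in> W" "y \<in> W" for x y
    using that by (simp add: W_def inner_add_right)
  have W_scale: "c *\<^sub>R x \<in> W" if "x \<in> W" for c x
    using that by (simp add: W_def)
  have W_A: "A *v x \<in> W" if "x \<in> W" for x
    unfolding W_def
  proof safe
    fix b assume b: "b \<in> B"
    obtain \<mu> where "A *v b = \<mu> *\<^sub>R b" using eig[OF b] by blast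
    then show "b \<bullet> (A *v x) = 0"
      using that b by (simp add: symmetric_matrix_inner[OF sym] W_def)
  qed
  have "dim B < DIM(real^'n)"
    using card dim_le_card'[OF fin] by simp
  then obtain x where x: "x \<noteq> 0" "\<And>y. y \<in> span B \<Longrightarrow> orthogonal x y"
    using orthogonal_to_subspace_exists by blast
  then have xW: "x \<in> W"
    by (auto simp: W_def orthogonal_def inner_commute span_base)
  define S where "S = sphere 0 1 \<inter> W"
  have closedW: "closed W"
  proof -
    have "W = (\<Inter>b\<in>B. {x. b \<bullet> x = 0})" by (auto simp: W_def)
    then show ?thesis by (auto intro!: closed_INT closed_hyperplane)
  qed
  have "compact S" unfolding S_def by (intro compact_Int_closed closedW) simp
  moreover have "(1 / norm x) *\<^sub>R x \<in> S"
    using x(1) W_scale[OF xW] by (simp add: S_def)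
  moreover have "continuous_on S (\<lambda>x. x \<bullet> (A *v x))"
    by (intro continuous_intros matrix_vector_mult_linear_continuous_on)
  ultimately obtain v where vS: "v \<in> S" and vmax: "\<And>y. y \<in> S \<Longrightarrow> y \<bullet> (A *v y) \<le> v \<bullet> (A *v v)"
    using continuous_attains_sup[of S "\<lambda>x. x \<bullet> (A *v x)"] by auto
  define \<mu> where "\<mu> = v \<bullet> (A *v v)"
  have v1: "norm v = 1" and vW: "v \<in> W" using vS by (auto simp: S_def)
  have le: "y \<bullet> (A *v y) \<le> \<mu> * (y \<bullet> y)" if "y \<in> W" for y
  proof (cases "y = 0")
    case False
    have "(1 / norm y) *\<^sub>R y \<in> S" using False W_scale[OF that] by (simp add: S_def)
    from vmax[OF this] have "(y \<bullet> (A *v y)) / (norm y)\<^sup>2 \<le> \<mu>"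
      by (simp add: \<mu>_def matrix_vector_mult_scaleR power2_eq_square)
    then show ?thesis using False
      by (simp add: divide_simps power2_norm_eq_inner)
  qed simp
  \<comment> \<open>The residual \<open>w\<close> stays in \<open>W\<close>. Moving from
    \<open>v\<close> to \<open>v + t *\<^sub>R w\<close> changes
    \<open>x \<bullet> (A *v x) - \<mu> * (x \<bullet> x)\<close> by a quadratic in \<open>t\<close>
    with linear coefficient \<open>2 * (w \<bullet> w)\<close>, so maximality forces
    \<open>w = 0\<close>.\<close>
  define w where "w = A *v v - \<mu> *\<^sub>R v"
  have wW: "w \<in> W"
    using W_add[OF W_A[OF vW] W_scale[OF vW, of "-\<mu>"]] by (simp add: w_def)
  have "2 * t * (w \<bullet> w) + t\<^sup>2 * (w \<bullet> (A *v w) - \<mu> * (w \<bullet> w)) \<le> 0" for t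
  proof -
    have "(v + t *\<^sub>R w) \<bullet> (A *v (v + t *\<^sub>R w)) \<le> \<mu> * ((v + t *\<^sub>R w) \<bullet> (v + t *\<^sub>R w))"
      by (intro le W_add vW W_scale wW)
    moreover have "v \<bullet> (A *v w) = w \<bullet> (A *v v)"
      by (metis symmetric_matrix_inner[OF sym] inner_commute)
    moreover have "w \<bullet> (A *v v) = w \<bullet> w + \<mu> * (w \<bullet> v)"
      by (simp add: w_def inner_diff_right inner_commute algebra_simps)
    moreover have "v \<bullet> v = 1" using v1 by (simp add: norm_eq_1)
    ultimately show ?thesis
      by (simp add: inner_add_left inner_add_right matrix_vector_right_distrib
          matrix_vector_mult_scaleR \<mu>_def[symmetric] algebra_simps power2_eq_square inner_commute[of v w])
  qed
  then have "w \<bullet> w = 0" by (rule zero_if_quadratic_nonpos)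
  then have "A *v v = \<mu> *\<^sub>R v" by (simp add: w_def)
  then show ?thesis using v1 vW by (auto simp: W_def)
qed

definition eigenbasis :: "real^'n^'n \<Rightarrow> ('n \<Rightarrow> real^'n) \<Rightarrow> ('n \<Rightarrow> real) \<Rightarrow> bool" where
  "eigenbasis A v a \<longleftrightarrow> orthonormal v \<and> (\<forall>i. A *v v i = a i *\<^sub>R v i)"

text \<open>An orthonormal set of eigenvectors is enlarged one vector at a time up to the dimension;
  a bijection with the index type then turns it into a family.\<close>

theorem spectral_theorem:
  fixes A :: "real^'n^'n"
  assumes sym: "transpose A = A"
  shows "\<exists>v a. eigenbasis A v a"
proof -
  have "\<exists>B. finite B \<and> card B = k \<and> (\<forall>b\<in>B. norm b = 1 \<and> (\<exists>\<mu>. A *v b = \<mu> *\<^sub>R b))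
      \<and> (\<forall>b\<in>B. \<forall>c\<in>B. b \<noteq> c \<longrightarrow> b \<bullet> c = 0)" if "k \<le> CARD('n)" for k
    using that
  proof (induction k)
    case 0
    show ?case by (intro exI[of _ "{}"]) simp
  next
    case (Suc k)
    then obtain B where B: "finite B" "card B = k"
      "\<And>b. b \<in> B \<Longrightarrow> norm b = 1 \<and> (\<exists>\<mu>. A *v b = \<mu> *\<^sub>R b)"
      "\<And>b c. b \<in> B \<Longrightarrow> c \<in> B \<Longrightarrow> b \<noteq> c \<Longrightarrow> b \<bullet> c = 0"
      by auto
    obtain v \<mu> where v: "norm v = 1" "\<And>b. b \<in> B \<Longrightarrow> b \<bullet> v = 0" "A *v v = \<mu> *\<^sub>R v"
      using eigenvector_in_complement[OF sym _ B(1)] B(2,3) Suc.prems by (metis Suc_le_lessD)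
    have "v \<notin> B" using v by (metis inner_eq_zero_iff norm_zero zero_neq_one)
    then show ?case
      using B v by (intro exI[of _ "insert v B"]) (auto simp: inner_commute)
  qed
  then obtain B where B: "finite B" "card B = CARD('n)"
    "\<And>b. b \<in> B \<Longrightarrow> norm b = 1" "\<And>b. b \<in> B \<Longrightarrow> \<exists>\<mu>. A *v b = \<mu> *\<^sub>R b"
    "\<And>b c. b \<in> B \<Longrightarrow> c \<in> B \<Longrightarrow> b \<noteq> c \<Longrightarrow> b \<bullet> c = 0"
    by (meson order_refl)
  obtain v :: "'n \<Rightarrow> real^'n" where v: "bij_betw v UNIV B"
    using finite_same_card_bij[of "UNIV :: 'n set" B] B by auto
  have vB: "v i \<in> B" for i using v by (auto simp: bij_betw_def)
  have vi: "v i = v j \<longleftrightarrow> i = j" for i j using v by (auto simp: bij_betw_def inj_def)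
  have "orthonormal v"
    unfolding orthonormal_def
  proof (intro allI)
    fix i j show "v i \<bullet> v j = (if i = j then 1 else 0)"
      using B(3)[OF vB, of i] B(5)[OF vB vB, of i j] vi[of i j] by (auto simp: norm_eq_1)
  qed
  moreover obtain a where "\<And>i. A *v v i = a i *\<^sub>R v i" using B(4)[OF vB] by metis
  ultimately show ?thesis unfolding eigenbasis_def by blast
qed

lemma eigenbasis_inner:
  assumes "eigenbasis A v a" "transpose A = A"
  shows "v i \<bullet> (A *v x) = a i * (v i \<bullet> x)"
  using assms by (simp add: symmetric_matrix_inner eigenbasis_def)

section \<open>Operator norm, spectrum and smallest eigenvalue\<close>

lemma spec_norm_le: "norm (A *v x) \<le> spec_norm A * norm x"
  unfolding spec_norm_def by (intro onorm matrix_vector_mul_bounded_linear)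

lemma spec_norm_least: "(\<And>x. norm (A *v x) \<le> c * norm x) \<Longrightarrow> spec_norm A \<le> c"
  unfolding spec_norm_def by (rule onorm_le) 

text \<open>Pairing the eigenvalue equation with \<open>v i\<close> gives
  \<open>(a i - \<mu>) * (v i \<bullet> x) = 0\<close>. The computation of the spectrum and the
  well-definedness of \<open>spec_reg\<close> both rest on this.\<close>

lemma eigenvalue_of_eigenbasis:
  fixes A :: "real^'n^'n"
  assumes eb: "eigenbasis A v a" and sym: "transpose A = A"
    and x: "A *v x = \<mu> *\<^sub>R x"
  shows "a i = \<mu> \<or> v i \<bullet> x = 0"
  using eigenbasis_inner[OF eb sym, of i x] x by auto

text \<open>In particular the spectrum is finite and nonempty, so the \<open>Min\<close> in
  \<open>lambda_min\<close> is a genuine minimum.\<close>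

lemma eigvals_eigenbasis:
  assumes eb: "eigenbasis A v a" and sym: "transpose A = A"
  shows "eigvals A = range a"
proof
  have on: "orthonormal v" using eb by (simp add: eigenbasis_def)
  show "eigvals A \<subseteq> range a"
  proof
    fix \<mu> assume "\<mu> \<in> eigvals A"
    then obtain x where x: "x \<noteq> 0" "A *v x = \<mu> *\<^sub>R x" by (auto simp: eigvals_def)
    have "\<exists>i. v i \<bullet> x \<noteq> 0"
    proof (rule ccontr)
      assume "\<nexists>i. v i \<bullet> x \<noteq> 0"
      then show False using orthonormal_norm[OF on, of x] x(1) by simp
    qed
    then show "\<mu> \<in> range a" using eigenvalue_of_eigenbasis[OF eb sym x(2)] by (metis rangeI)
  qed
  show "range a \<subseteq> eigvals A"
  proof
    fix \<mu> assume "\<mu> \<in> range a"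
    then obtain i where i: "\<mu> = a i" by auto
    have "v i \<noteq> 0" using on by (metis inner_zero_left orthonormal_def zero_neq_one)
    then show "\<mu> \<in> eigvals A" using eb i by (auto simp: eigvals_def eigenbasis_def)
  qed
qed

lemma lambda_min_quadratic:
  fixes A :: "real^'n^'n"
  assumes sym: "transpose A = A"
  shows "lambda_min A * (norm x)\<^sup>2 \<le> x \<bullet> (A *v x)"
proof -
  obtain v a where eb: "eigenbasis A v a" using spectral_theorem[OF sym] by blast
  then have on: "orthonormal v" by (simp add: eigenbasis_def)
  have "lambda_min A \<le> a i" for i
    unfolding lambda_min_def eigvals_eigenbasis[OF eb sym] by (intro Min_le) auto
  then have "lambda_min A * (norm x)\<^sup>2 \<le> (\<Sum>i\<in>UNIV. a i * (v i \<bullet> x)\<^sup>2)"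
    unfolding orthonormal_norm[OF on] sum_distrib_left by (intro sum_mono mult_right_mono) auto
  also have "\<dots> = x \<bullet> (A *v x)"
    by (subst orthonormal_inner[OF on])
      (simp add: eigenbasis_inner[OF eb sym] power2_eq_square mult_ac)
  finally show ?thesis .
qed

text \<open>The definite description in \<open>spec_reg\<close> is meaningful: the matrix that clips
  the eigenvalues in one eigenbasis acts as required on every eigenvector, and any competitor agrees
  with it on that basis.\<close>

lemma spec_reg_eigenbasis:
  fixes A :: "real^'n^'n"
  assumes eb: "eigenbasis A v a" and sym: "transpose A = A"
  shows "spec_reg lam A *v x = (\<Sum>i\<in>UNIV. (max (a i) lam * (v i \<bullet> x)) *\<^sub>R v i)"
proof -
  have on: "orthonormal v" using eb by (simp add: eigenbasis_def)
  define N where "N = matrix (\<lambda>x. \<Sum>i\<in>UNIV. (max (a i) lam * (v i \<bullet> x)) *\<^sub>R v i)"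
  have "linear (\<lambda>x. \<Sum>i\<in>UNIV. (max (a i) lam * (v i \<bullet> x)) *\<^sub>R v i)"
    by (rule linearI) (simp_all add: inner_add_right algebra_simps sum.distrib scaleR_sum_right)
  then have N: "N *v x = (\<Sum>i\<in>UNIV. (max (a i) lam * (v i \<bullet> x)) *\<^sub>R v i)" for x
    by (simp add: N_def matrix_works)
  have N_eig: "N *v x = max \<mu> lam *\<^sub>R x" if x: "A *v x = \<mu> *\<^sub>R x" for x \<mu>
  proof -
    \<comment> \<open>Either \<open>a i = \<mu>\<close> or the component vanishes, so the common
      factor \<open>max \<mu> lam\<close> can be pulled out even when \<open>x\<close> is not a
      basis vector.\<close>
    have "(max (a i) lam * (v i \<bullet> x)) *\<^sub>R v i = max \<mu> lam *\<^sub>R ((v i \<bullet> x) *\<^sub>R v i)" for i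
      using eigenvalue_of_eigenbasis[OF eb sym x, of i] by auto
    then show ?thesis
      unfolding N by (simp add: scaleR_sum_right[symmetric] orthonormal_expand[OF on, symmetric] del: scaleR_scaleR)
  qed
  have "spec_reg lam A = N"
    unfolding spec_reg_def
  proof (rule the_equality)
    show "\<forall>x \<mu>. A *v x = \<mu> *\<^sub>R x \<longrightarrow> N *v x = max \<mu> lam *\<^sub>R x" using N_eig by blast
  next
    fix M assume M: "\<forall>x \<mu>. A *v x = \<mu> *\<^sub>R x \<longrightarrow> M *v x = max \<mu> lam *\<^sub>R x"
    have Mv: "M *v v i = N *v v i" for i
      using M N_eig eb by (metis eigenbasis_def)
    have "M *v x = N *v x" for x
      by (subst (1 2) orthonormal_expand[OF on, of x])
        (simp add: matrix_vector_mult_sum_right matrix_vector_mult_scaleR Mv)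
    then show "M = N" by (simp add: matrix_eq)
  qed
  then show ?thesis using N by simp
qed

section \<open>Spectral regularization\<close>

text \<open>Triangle inequality on the expansion of \<open>x\<close>, then Cauchy-Schwarz. The
  square root is the Frobenius norm of \<open>C\<close>, computed in the basis
  \<open>w\<close>.\<close>

lemma norm_matrix_vector_le_frobenius:
  fixes C :: "real^'n^'n"
  assumes on: "orthonormal w"
  shows "norm (C *v x) \<le> sqrt (\<Sum>j\<in>UNIV. (norm (C *v w j))\<^sup>2) * norm x"
proof -
  have "C *v x = (\<Sum>j\<in>UNIV. (w j \<bullet> x) *\<^sub>R (C *v w j))"
    by (subst orthonormal_expand[OF on, of x])
      (simp only: matrix_vector_mult_sum_right matrix_vector_mult_scaleR)
  then have "norm (C *v x) \<le> (\<Sum>j\<in>UNIV. \<bar>w j \<bullet> x\<bar> * \<bar>norm (C *v w j)\<bar>)"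
    by (metis (no_types, lifting) norm_sum norm_scaleR abs_norm_cancel sum.cong)
  also have "\<dots> \<le> L2_set (\<lambda>j. w j \<bullet> x) UNIV * L2_set (\<lambda>j. norm (C *v w j)) UNIV"
    by (rule L2_set_mult_ineq)
  also have "L2_set (\<lambda>j. w j \<bullet> x) UNIV = norm x"
    by (simp add: L2_set_def orthonormal_norm[OF on, symmetric])
  finally show ?thesis by (simp add: L2_set_def mult.commute)
qed

text \<open>These mixed entries, with rows from an eigenbasis of \<open>A\<close> and columns from
  one of \<open>B\<close>, allow noncommuting matrices to be compared through differences of their
  eigenvalues.\<close>

lemma eigenbasis_diff_inner:
  fixes A B :: "real^'n^'n"
  assumes A: "eigenbasis A u a" "transpose A = A" and B: "eigenbasis B w b"
  shows "u i \<bullet> ((A - B) *v w j) = (a i - b j) * (u i \<bullet> w j)"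
  using B by (simp add: matrix_vector_mult_diff_rdistrib inner_diff_right eigenbasis_inner[OF A]
      eigenbasis_def left_diff_distrib)

lemma spec_reg_inner:
  fixes A :: "real^'n^'n"
  assumes eb: "eigenbasis A v a" and sym: "transpose A = A"
  shows "v i \<bullet> (spec_reg lam A *v x) = max (a i) lam * (v i \<bullet> x)"
proof -
  have vv: "v i \<bullet> v j = (if i = j then 1 else 0)" for j
    using eb by (simp add: eigenbasis_def orthonormal_def)
  show ?thesis
    by (simp add: spec_reg_eigenbasis[OF eb sym] inner_sum_right vv if_distrib[of "\<lambda>c. _ * c"] cong: if_cong)
qed

lemma spec_reg_eigenvector:
  fixes A :: "real^'n^'n"
  assumes eb: "eigenbasis A v a" and sym: "transpose A = A"
  shows "spec_reg lam A *v v j = max (a j) lam *\<^sub>R v j"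
proof -
  have on: "orthonormal v" using eb by (simp add: eigenbasis_def)
  have "spec_reg lam A *v v j = (\<Sum>i\<in>UNIV. (v i \<bullet> (spec_reg lam A *v v j)) *\<^sub>R v i)"
    by (rule orthonormal_expand[OF on])
  also have "\<dots> = (\<Sum>i\<in>UNIV. if i = j then max (a j) lam *\<^sub>R v j else 0)"
    using on by (intro sum.cong) (auto simp: spec_reg_inner[OF eb sym] orthonormal_def)
  finally show ?thesis by simp
qed

lemma spec_reg_commute:
  fixes A :: "real^'n^'n"
  assumes sym: "transpose A = A"
  shows "x \<bullet> (spec_reg lam A *v y) = y \<bullet> (spec_reg lam A *v x)"
proof -
  obtain v a where eb: "eigenbasis A v a" using spectral_theorem[OF sym] by blast
  then have on: "orthonormal v" by (simp add: eigenbasis_def)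
  show ?thesis
    unfolding orthonormal_inner[OF on, of x "spec_reg lam A *v y"]
      orthonormal_inner[OF on, of y "spec_reg lam A *v x"] spec_reg_inner[OF eb sym]
    by (intro sum.cong refl) simp
qed

lemma spec_reg_lower:
  fixes A :: "real^'n^'n"
  assumes sym: "transpose A = A"
  shows "lam * (norm x)\<^sup>2 \<le> x \<bullet> (spec_reg lam A *v x)"
proof -
  obtain v a where eb: "eigenbasis A v a" using spectral_theorem[OF sym] by blast
  then have on: "orthonormal v" by (simp add: eigenbasis_def)
  have "lam * (norm x)\<^sup>2 \<le> (\<Sum>i\<in>UNIV. max (a i) lam * (v i \<bullet> x)\<^sup>2)"
    unfolding orthonormal_norm[OF on] sum_distrib_left by (intro sum_mono mult_right_mono) auto
  also have "\<dots> = x \<bullet> (spec_reg lam A *v x)"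
    by (subst orthonormal_inner[OF on])
      (simp add: spec_reg_inner[OF eb sym] power2_eq_square mult_ac)
  finally show ?thesis .
qed

text \<open>Clipping at \<open>lam\<close> is 1-Lipschitz on the reals, so it shrinks every mixed
  entry in absolute value. Each of the \<open>CARD('n)\<close> columns of the difference thus has
  norm at most \<open>spec_norm (A - B)\<close>, and passing through the Frobenius norm costs the
  square root of the dimension.\<close>

lemma spec_reg_lipschitz:
  fixes A B :: "real^'n^'n"
  assumes symA: "transpose A = A" and symB: "transpose B = B"
  shows "norm (spec_reg lam A *v x - spec_reg lam B *v x)
    \<le> sqrt (real CARD('n)) * spec_norm (A - B) * norm x"
proof -
  obtain u a where A: "eigenbasis A u a" using spectral_theorem[OF symA] by blast
  obtain w b where B: "eigenbasis B w b" using spectral_theorem[OF symB] by blast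
  have onu: "orthonormal u" and onw: "orthonormal w" using A B by (simp_all add: eigenbasis_def)
  have w1: "norm (w j) = 1" for j using onw by (simp add: orthonormal_def norm_eq_1)
  define C where "C = spec_reg lam A - spec_reg lam B"
  have "(norm (C *v w j))\<^sup>2 \<le> (spec_norm (A - B))\<^sup>2" for j
  proof -
    have "u i \<bullet> (C *v w j) = (max (a i) lam - max (b j) lam) * (u i \<bullet> w j)" for i
      by (simp add: C_def matrix_vector_mult_diff_rdistrib inner_diff_right spec_reg_inner[OF A symA]
          spec_reg_eigenvector[OF B symB] left_diff_distrib)
    then have "(norm (C *v w j))\<^sup>2 = (\<Sum>i\<in>UNIV. ((max (a i) lam - max (b j) lam) * (u i \<bullet> w j))\<^sup>2)"
      by (simp add: orthonormal_norm[OF onu])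
    also have "\<dots> \<le> (\<Sum>i\<in>UNIV. ((a i - b j) * (u i \<bullet> w j))\<^sup>2)"
      unfolding power_mult_distrib
      by (intro sum_mono mult_right_mono) (auto simp: abs_le_square_iff[symmetric] max_def)
    also have "\<dots> = (norm ((A - B) *v w j))\<^sup>2"
      by (simp add: orthonormal_norm[OF onu] eigenbasis_diff_inner[OF A symA B])
    also have "\<dots> \<le> (spec_norm (A - B))\<^sup>2"
      using spec_norm_le[of "A - B" "w j"] by (intro power_mono) (simp_all add: w1)
    finally show ?thesis .
  qed
  then have "(\<Sum>j\<in>UNIV. (norm (C *v w j))\<^sup>2) \<le> real CARD('n) * (spec_norm (A - B))\<^sup>2"
    using sum_bounded_above[of "UNIV :: 'n set" "\<lambda>j. (norm (C *v w j))\<^sup>2"] by simp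
  then have "sqrt (\<Sum>j\<in>UNIV. (norm (C *v w j))\<^sup>2) \<le> sqrt (real CARD('n)) * \<bar>spec_norm (A - B)\<bar>"
    unfolding real_sqrt_abs[symmetric] real_sqrt_mult[symmetric] by (rule real_sqrt_le_mono)
  moreover have "0 \<le> spec_norm (A - B)"
    unfolding spec_norm_def by (intro onorm_pos_le matrix_vector_mul_bounded_linear)
  ultimately have "sqrt (\<Sum>j\<in>UNIV. (norm (C *v w j))\<^sup>2) \<le> sqrt (real CARD('n)) * spec_norm (A - B)"
    by simp
  from order_trans[OF norm_matrix_vector_le_frobenius[OF onw] mult_right_mono[OF this]]
  have "norm (C *v x) \<le> sqrt (real CARD('n)) * spec_norm (A - B) * norm x"
    by simp
  then show ?thesis by (simp add: C_def matrix_vector_mult_diff_rdistrib)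
qed

text \<open>The bound on the quadratic form keeps every eigenvalue at or above \<open>c\<close>, so
  clipping at \<open>lam\<close> moves each by at most \<open>lam - c\<close>.\<close>

lemma spec_reg_diff:
  fixes A :: "real^'n^'n"
  assumes sym: "transpose A = A" and lower: "\<And>x. c * (norm x)\<^sup>2 \<le> x \<bullet> (A *v x)" and c: "c \<le> lam"
  shows "norm (spec_reg lam A *v x - A *v x) \<le> (lam - c) * norm x"
proof -
  obtain v a where eb: "eigenbasis A v a" using spectral_theorem[OF sym] by blast
  then have on: "orthonormal v" by (simp add: eigenbasis_def)
  have vv: "v i \<bullet> v i = 1" for i using on by (simp add: orthonormal_def)
  have a: "c \<le> a i" for i
    using lower[of "v i"] eb vv[of i] by (simp add: eigenbasis_def power2_norm_eq_inner)
  have "v i \<bullet> (spec_reg lam A *v x - A *v x) = (max (a i) lam - a i) * (v i \<bullet> x)" for i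
    by (simp add: inner_diff_right spec_reg_inner[OF eb sym] eigenbasis_inner[OF eb sym] left_diff_distrib)
  then have "(norm (spec_reg lam A *v x - A *v x))\<^sup>2 = (\<Sum>i\<in>UNIV. (max (a i) lam - a i)\<^sup>2 * (v i \<bullet> x)\<^sup>2)"
    by (simp only: orthonormal_norm[OF on] power_mult_distrib)
  also have "\<dots> \<le> (\<Sum>i\<in>UNIV. (lam - c)\<^sup>2 * (v i \<bullet> x)\<^sup>2)"
  proof (intro sum_mono mult_right_mono)
    fix i show "(max (a i) lam - a i)\<^sup>2 \<le> (lam - c)\<^sup>2"
      using a[of i] c by (intro power_mono) auto
  qed simp
  also have "\<dots> = ((lam - c) * norm x)\<^sup>2"
    by (simp add: power_mult_distrib orthonormal_norm[OF on] sum_distrib_left)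
  finally show ?thesis by (rule power2_le_imp_le) (use c in simp)
qed

section \<open>Matrix concentration by exchangeable pairs\<close>

text \<open>\<open>eigvec\<close> and \<open>eigval\<close> project the same chosen pair, so
  eigenvectors and eigenvalues match index by index.\<close>

definition eigvec :: "real^'n^'n \<Rightarrow> 'n \<Rightarrow> real^'n" where
  "eigvec A = fst (SOME p. eigenbasis A (fst p) (snd p))"

definition eigval :: "real^'n^'n \<Rightarrow> 'n \<Rightarrow> real" where
  "eigval A = snd (SOME p. eigenbasis A (fst p) (snd p))"

lemma eigenbasis_eigvec_eigval:
  assumes "transpose A = A"
  shows "eigenbasis A (eigvec A) (eigval A)"
proof -
  have "\<exists>p. eigenbasis A (fst p) (snd p)" using spectral_theorem[OF assms] by simp
  from someI_ex[OF this] show ?thesis by (simp only: eigvec_def eigval_def)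
qed

text \<open>The trace of \<open>\<phi>(A) C\<close>, computed in an eigenbasis of the symmetric matrix \<open>A\<close>.\<close>
definition trace_fun :: "(real \<Rightarrow> real) \<Rightarrow> real^'n^'n \<Rightarrow> real^'n^'n \<Rightarrow> real" where
  "trace_fun \<phi> A C = (\<Sum>i\<in>UNIV. \<phi> (eigval A i) * (eigvec A i \<bullet> (C *v eigvec A i)))"

lemma trace_fun_diff: "trace_fun \<phi> A (C - E) = trace_fun \<phi> A C - trace_fun \<phi> A E"
  by (simp add: trace_fun_def matrix_vector_mult_diff_rdistrib inner_diff_right right_diff_distrib sum_subtractf)

lemma trace_fun_zero [simp]: "trace_fun \<phi> A 0 = 0"
  by (simp add: trace_fun_def)

lemma trace_fun_add: "trace_fun \<phi> A (C + E) = trace_fun \<phi> A C + trace_fun \<phi> A E"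
  by (simp add: trace_fun_def matrix_vector_mult_add_rdistrib inner_add_right distrib_left sum.distrib)

lemma trace_fun_sum: "trace_fun \<phi> A (sum g S) = (\<Sum>i\<in>S. trace_fun \<phi> A (g i))"
  by (induction S rule: infinite_finite_induct) (simp_all add: trace_fun_add)

lemma trace_fun_self:
  assumes "transpose A = A"
  shows "trace_fun \<phi> A A = (\<Sum>i\<in>UNIV. eigval A i * \<phi> (eigval A i))"
  using eigenbasis_eigvec_eigval[OF assms]
  by (simp add: trace_fun_def eigenbasis_def orthonormal_def mult_ac)

section \<open>Hyperbolic inequalities for eigenvalues and traces\<close>

text \<open>With \<open>s\<close> and \<open>r\<close> the half sum and half difference of
  \<open>\<theta> * a\<close> and \<open>\<theta> * b\<close>, both sides contain the factor
  \<open>cosh s\<close>, and \<open>r * sinh r \<le> r\<^sup>2 * cosh r\<close> remains.\<close>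

lemma sinh_diff_le_cosh:
  fixes a b \<theta> :: real
  assumes "\<theta> \<ge> 0"
  shows "(a - b) * (sinh (\<theta> * a) - sinh (\<theta> * b)) \<le> \<theta> / 2 * (a - b)\<^sup>2 * (cosh (\<theta> * a) + cosh (\<theta> * b))"
proof -
  \<comment> \<open>This is \<open>tanh r \<le> r\<close> cleared of its denominator; the difference
    of the two sides has derivative \<open>r * sinh r\<close>.\<close>
  have tanh_le: "sinh r \<le> r * cosh r" if "r \<ge> 0" for r :: real
  proof -
    have "(\<lambda>r::real. r * cosh r - sinh r) 0 \<le> (\<lambda>r. r * cosh r - sinh r) r"
    proof (rule DERIV_nonneg_imp_nondecreasing[OF that])
      fix x :: real assume "0 \<le> x" "x \<le> r"
      then show "\<exists>y. ((\<lambda>r. r * cosh r - sinh r) has_real_derivative y) (at x) \<and> 0 \<le> y"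
        by (intro exI[of _ "x * sinh x"]) (auto intro!: derivative_eq_intros)
    qed
    then show ?thesis by simp
  qed
  have key: "r * sinh r \<le> r\<^sup>2 * cosh r" for r :: real
  proof (cases "r \<ge> 0")
    case True
    then show ?thesis using mult_left_mono[OF tanh_le[OF True] True]
      by (simp add: power2_eq_square mult_ac)
  next
    case False
    then show ?thesis using mult_left_mono[OF tanh_le[of "-r"], of "-r"]
      by (simp add: power2_eq_square mult_ac)
  qed
  define s r where "s = \<theta> * (a + b) / 2" and "r = \<theta> * (a - b) / 2"
  have ab: "\<theta> * a = s + r" "\<theta> * b = s - r" by (simp_all add: s_def r_def field_simps)
  \<comment> \<open>The extra factor turns \<open>\<theta> * (a - b)\<close> into
    \<open>2 * r\<close> without a division; \<open>\<theta> = 0\<close> is settled separately at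
    the end.\<close>
  have "\<theta> * ((a - b) * (sinh (\<theta> * a) - sinh (\<theta> * b))) = 4 * cosh s * (r * sinh r)"
    unfolding ab sinh_add sinh_diff by (simp add: r_def algebra_simps)
  also have "\<dots> \<le> 4 * cosh s * (r\<^sup>2 * cosh r)"
    by (intro mult_left_mono key) simp
  also have "\<dots> = \<theta> * (\<theta> / 2 * (a - b)\<^sup>2 * (cosh (\<theta> * a) + cosh (\<theta> * b)))"
  proof -
    have "4 * r\<^sup>2 = \<theta>\<^sup>2 * (a - b)\<^sup>2"
      by (simp add: r_def power_divide power_mult_distrib)
    moreover have "cosh (s + r) + cosh (s - r) = 2 * cosh s * cosh r"
      by (simp add: cosh_add cosh_diff)
    ultimately show ?thesis
      unfolding ab by (simp add: power2_eq_square)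
  qed
  finally have "\<theta> * ((a - b) * (sinh (\<theta> * a) - sinh (\<theta> * b)))
    \<le> \<theta> * (\<theta> / 2 * (a - b)\<^sup>2 * (cosh (\<theta> * a) + cosh (\<theta> * b)))" .
  then show ?thesis
  proof (cases "\<theta> = 0")
    case False
    with assms have "\<theta> > 0" by simp
    with \<open>\<theta> * _ \<le> \<theta> * _\<close> show ?thesis by (rule mult_left_le_imp_le)
  qed simp
qed

text \<open>The mean value trace inequality of Mackey, Jordan, Chen, Farrell and Tropp: both sides are sums
  of a function of the two eigenvalues \<open>a\<close>, \<open>b\<close> against the weights \<open>(u i \<bullet> w j)\<^sup>2\<close>, which reduces
  it to the scalar case.\<close>
lemma mean_value_trace_inequality:
  fixes A B :: "real^'n^'n"
  assumes symA: "transpose A = A" and symB: "transpose B = B" and \<theta>: "\<theta> \<ge> 0"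
    and s: "\<And>x. norm ((A - B) *v x) \<le> s * norm x"
  shows "trace_fun (\<lambda>t. sinh (\<theta> * t)) A (A - B) - trace_fun (\<lambda>t. sinh (\<theta> * t)) B (A - B)
    \<le> \<theta> * s\<^sup>2 / 2 * ((\<Sum>i\<in>UNIV. cosh (\<theta> * eigval A i)) + (\<Sum>i\<in>UNIV. cosh (\<theta> * eigval B i)))"
proof -
  define u a w b where "u = eigvec A" and "a = eigval A" and "w = eigvec B" and "b = eigval B"
  have A: "eigenbasis A u a" and B: "eigenbasis B w b"
    unfolding u_def a_def w_def b_def by (rule eigenbasis_eigvec_eigval; fact)+
  have onu: "orthonormal u" and onw: "orthonormal w" using A B by (simp_all add: eigenbasis_def)
  have u1: "norm (u i) = 1" and w1: "norm (w i) = 1" for i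
    using onu onw by (simp_all add: orthonormal_def norm_eq_1)
  have symAB: "transpose (A - B) = A - B"
    using symA symB by (simp add: transpose_def vec_eq_iff)
  have ip: "u i \<bullet> ((A - B) *v w j) = (a i - b j) * (u i \<bullet> w j)" for i j
    by (rule eigenbasis_diff_inner[OF A symA B])
  have ip': "w j \<bullet> ((A - B) *v u i) = (a i - b j) * (u i \<bullet> w j)" for i j
    by (metis ip symmetric_matrix_inner[OF symAB] inner_commute)
  have uu: "u i \<bullet> ((A - B) *v u i) = (\<Sum>j\<in>UNIV. (a i - b j) * (u i \<bullet> w j)\<^sup>2)" for i
    by (subst orthonormal_inner[OF onw]) (simp add: ip' inner_commute[of "w _" "u i"] power2_eq_square mult_ac)
  have ww: "w j \<bullet> ((A - B) *v w j) = (\<Sum>i\<in>UNIV. (a i - b j) * (u i \<bullet> w j)\<^sup>2)" for j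
    by (subst orthonormal_inner[OF onu]) (simp add: ip power2_eq_square mult_ac)
  \<comment> \<open>Parseval in the basis \<open>w\<close>: the row sum is the squared norm of
    \<open>(A - B) *v u i\<close>.\<close>
  have nu: "(\<Sum>j\<in>UNIV. (a i - b j)\<^sup>2 * (u i \<bullet> w j)\<^sup>2) \<le> s\<^sup>2" for i
  proof -
    have "(\<Sum>j\<in>UNIV. (a i - b j)\<^sup>2 * (u i \<bullet> w j)\<^sup>2) = (norm ((A - B) *v u i))\<^sup>2"
      by (simp add: orthonormal_norm[OF onw] ip' power_mult_distrib)
    also have "\<dots> \<le> s\<^sup>2" using s[of "u i"] by (intro power_mono) (simp_all add: u1)
    finally show ?thesis .
  qed
  have nw: "(\<Sum>i\<in>UNIV. (a i - b j)\<^sup>2 * (u i \<bullet> w j)\<^sup>2) \<le> s\<^sup>2" for j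
  proof -
    have "(\<Sum>i\<in>UNIV. (a i - b j)\<^sup>2 * (u i \<bullet> w j)\<^sup>2) = (norm ((A - B) *v w j))\<^sup>2"
      by (simp add: orthonormal_norm[OF onu] ip power_mult_distrib)
    also have "\<dots> \<le> s\<^sup>2" using s[of "w j"] by (intro power_mono) (simp_all add: w1)
    finally show ?thesis .
  qed
  have "trace_fun (\<lambda>t. sinh (\<theta> * t)) A (A - B)
      = (\<Sum>i\<in>UNIV. \<Sum>j\<in>UNIV. sinh (\<theta> * a i) * ((a i - b j) * (u i \<bullet> w j)\<^sup>2))"
    unfolding trace_fun_def u_def[symmetric] a_def[symmetric] uu sum_distrib_left ..
  moreover have "trace_fun (\<lambda>t. sinh (\<theta> * t)) B (A - B)
      = (\<Sum>i\<in>UNIV. \<Sum>j\<in>UNIV. sinh (\<theta> * b j) * ((a i - b j) * (u i \<bullet> w j)\<^sup>2))"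
    unfolding trace_fun_def w_def[symmetric] b_def[symmetric] ww sum_distrib_left by (rule sum.swap)
  ultimately have "trace_fun (\<lambda>t. sinh (\<theta> * t)) A (A - B) - trace_fun (\<lambda>t. sinh (\<theta> * t)) B (A - B)
     = (\<Sum>i\<in>UNIV. \<Sum>j\<in>UNIV. (a i - b j) * (sinh (\<theta> * a i) - sinh (\<theta> * b j)) * (u i \<bullet> w j)\<^sup>2)"
    by (simp add: sum_subtractf[symmetric] algebra_simps)
  also have "\<dots> \<le> (\<Sum>i\<in>UNIV. \<Sum>j\<in>UNIV.
      \<theta> / 2 * (a i - b j)\<^sup>2 * (cosh (\<theta> * a i) + cosh (\<theta> * b j)) * (u i \<bullet> w j)\<^sup>2)"
    by (intro sum_mono mult_right_mono sinh_diff_le_cosh \<theta>) simp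
  \<comment> \<open>Each \<open>cosh\<close> depends on one index only, so the double sum splits and
    the inner sums are those bounded by \<open>nu\<close> and \<open>nw\<close>.\<close>
  also have "\<dots> = \<theta> / 2 * ((\<Sum>i\<in>UNIV. cosh (\<theta> * a i) * (\<Sum>j\<in>UNIV. (a i - b j)\<^sup>2 * (u i \<bullet> w j)\<^sup>2))
       + (\<Sum>j\<in>UNIV. cosh (\<theta> * b j) * (\<Sum>i\<in>UNIV. (a i - b j)\<^sup>2 * (u i \<bullet> w j)\<^sup>2)))"
    unfolding sum_distrib_left
    by (subst (3) sum.swap) (simp add: sum.distrib[symmetric] sum_distrib_left algebra_simps add_divide_distrib)
  also have "\<dots> \<le> \<theta> / 2 * ((\<Sum>i\<in>UNIV. cosh (\<theta> * a i) * s\<^sup>2) + (\<Sum>j\<in>UNIV. cosh (\<theta> * b j) * s\<^sup>2))"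
    using \<theta> by (intro mult_left_mono add_mono sum_mono nu nw) auto
  also have "\<dots> = \<theta> * s\<^sup>2 / 2 * ((\<Sum>i\<in>UNIV. cosh (\<theta> * a i)) + (\<Sum>i\<in>UNIV. cosh (\<theta> * b i)))"
    unfolding sum_distrib_right[symmetric] by (simp add: algebra_simps)
  finally show ?thesis by (simp add: a_def b_def)
qed

text \<open>The spectral norm of a symmetric matrix is its largest absolute eigenvalue. This
  direction turns a large norm into an eigenvalue that the trace of \<open>cosh\<close>
  detects.\<close>

lemma spec_norm_gt_eigval:
  fixes A :: "real^'n^'n"
  assumes sym: "transpose A = A" and t: "0 \<le> t" "t < spec_norm A"
  shows "\<exists>i. t < \<bar>eigval A i\<bar>"
proof (rule ccontr)
  assume "\<nexists>i. t < \<bar>eigval A i\<bar>"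
  then have le: "\<bar>eigval A i\<bar> \<le> t" for i by (meson not_le)
  have eb: "eigenbasis A (eigvec A) (eigval A)" by (rule eigenbasis_eigvec_eigval[OF sym])
  then have on: "orthonormal (eigvec A)" by (simp add: eigenbasis_def)
  have "spec_norm A \<le> t"
  proof (rule spec_norm_least)
    fix x
    have "(norm (A *v x))\<^sup>2 = (\<Sum>i\<in>UNIV. (eigval A i)\<^sup>2 * (eigvec A i \<bullet> x)\<^sup>2)"
      by (simp add: orthonormal_norm[OF on] eigenbasis_inner[OF eb sym] power_mult_distrib)
    also have "\<dots> \<le> (\<Sum>i\<in>UNIV. t\<^sup>2 * (eigvec A i \<bullet> x)\<^sup>2)"
      using le t by (intro sum_mono mult_right_mono) (auto simp flip: abs_le_square_iff)
    also have "\<dots> = (t * norm x)\<^sup>2"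
      by (simp add: power_mult_distrib orthonormal_norm[OF on] sum_distrib_left)
    finally show "norm (A *v x) \<le> t * norm x" by (rule power2_le_imp_le) (use t in simp)
  qed
  then show False using t by simp
qed

section \<open>Exchangeable pairs and the matrix Hoeffding bound\<close>

text \<open>The map from \<open>(S, r)\<close> to \<open>(S(j := r), S j)\<close> is an involution
  of the summation range. Under uniform weights this is the exchangeability of a sample and its
  resampled copy.\<close>

lemma sum_PiE_dflt_exchange:
  assumes j: "j \<in> I"
  shows "(\<Sum>S\<in>PiE_dflt I d (\<lambda>_. R). \<Sum>r\<in>R. G S r)
    = (\<Sum>S\<in>PiE_dflt I d (\<lambda>_. R). \<Sum>r\<in>R. G (S(j := r)) (S j))"
  unfolding sum.cartesian_product
  by (rule sum.reindex_bij_witness[where i = "\<lambda>(S, r). (S(j := r), S j)" and j = "\<lambda>(S, r). (S(j := r), S j)"])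
    (use j in \<open>auto simp: PiE_dflt_def\<close>)

text \<open>The method of exchangeable pairs: resampling coordinate \<open>j\<close> of \<open>S\<close> exchanges \<open>S\<close> with a copy
  whose matrix sum differs from that of \<open>S\<close> by a single summand.\<close>
lemma trace_sinh_le_trace_cosh:
  fixes g :: "'i \<Rightarrow> real^'n^'n" and d :: 'i and I :: "'j set"
  assumes I: "finite I" and R: "finite R" "R \<noteq> {}"
    and sym: "\<And>r. r \<in> R \<Longrightarrow> transpose (g r) = g r" and centered: "(\<Sum>r\<in>R. g r) = 0"
    and s: "\<And>q r x. q \<in> R \<Longrightarrow> r \<in> R \<Longrightarrow> norm ((g q - g r) *v x) \<le> s * norm x" and \<theta>: "\<theta> \<ge> 0"
  defines "\<Omega> \<equiv> PiE_dflt I d (\<lambda>_. R)" and "Y \<equiv> (\<lambda>S. \<Sum>j\<in>I. g (S j))"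
  shows "(\<Sum>S\<in>\<Omega>. trace_fun (\<lambda>t. sinh (\<theta> * t)) (Y S) (Y S))
    \<le> real (card I) * s\<^sup>2 / 2 * \<theta> * (\<Sum>S\<in>\<Omega>. \<Sum>i\<in>UNIV. cosh (\<theta> * eigval (Y S) i))"
proof -
  define T where "T = (\<lambda>S C. trace_fun (\<lambda>t. sinh (\<theta> * t)) (Y S) C)"
  define c where "c = (\<lambda>S. \<Sum>i\<in>UNIV. cosh (\<theta> * eigval (Y S) i))"
  have symY: "transpose (Y S) = Y S" if "S \<in> \<Omega>" for S
    using that unfolding Y_def transpose_sum
    by (intro sum.cong refl sym) (auto simp: \<Omega>_def PiE_dflt_def)
  have one: "(\<Sum>S\<in>\<Omega>. T S (g (S j))) \<le> s\<^sup>2 / 2 * \<theta> * (\<Sum>S\<in>\<Omega>. c S)" if j: "j \<in> I" for j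
  proof -
    have upd: "S(j := r) \<in> \<Omega>" if "S \<in> \<Omega>" "r \<in> R" for S r
      using that j by (auto simp: \<Omega>_def PiE_dflt_def)
    have SR: "S j \<in> R" if "S \<in> \<Omega>" for S using that j by (auto simp: \<Omega>_def PiE_dflt_def)
    have Yupd: "Y S - Y (S(j := r)) = g (S j) - g r" for S r
      using I j by (simp add: Y_def sum.remove[of I j])
    define Q where "Q = (\<Sum>S\<in>\<Omega>. \<Sum>r\<in>R. T S (g (S j) - g r))"
    \<comment> \<open>Averaging over the resampled index \<open>r\<close> removes
      \<open>g r\<close>, because the summands are centered.\<close>
    have "(\<Sum>r\<in>R. T S (g (S j) - g r)) = real (card R) * T S (g (S j))" for S
    proof -
      have "(\<Sum>r\<in>R. T S (g r)) = 0"
        by (simp add: T_def trace_fun_sum[symmetric] centered)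
      then show ?thesis by (simp add: T_def trace_fun_diff sum_subtractf)
    qed
    then have Q1: "Q = real (card R) * (\<Sum>S\<in>\<Omega>. T S (g (S j)))"
      by (simp add: Q_def sum_distrib_left)
    \<comment> \<open>Exchanging sample and copy flips the sign of the matrix argument. Adding the
      two expressions for \<open>Q\<close> gives the differences to which the mean value trace
      inequality applies.\<close>
    have "Q = (\<Sum>S\<in>\<Omega>. \<Sum>r\<in>R. T (S(j := r)) (g r - g (S j)))"
      unfolding Q_def \<Omega>_def by (subst sum_PiE_dflt_exchange[OF j]) simp
    also have "\<dots> = (\<Sum>S\<in>\<Omega>. \<Sum>r\<in>R. - T (S(j := r)) (g (S j) - g r))"
      by (simp add: T_def trace_fun_diff)
    finally have "2 * Q = (\<Sum>S\<in>\<Omega>. \<Sum>r\<in>R. T S (g (S j) - g r) - T (S(j := r)) (g (S j) - g r))"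
      by (simp add: Q_def sum_subtractf sum_negf)
    also have "\<dots> \<le> (\<Sum>S\<in>\<Omega>. \<Sum>r\<in>R. \<theta> * s\<^sup>2 / 2 * (c S + c (S(j := r))))"
    proof (intro sum_mono)
      fix S r assume S: "S \<in> \<Omega>" and r: "r \<in> R"
      show "T S (g (S j) - g r) - T (S(j := r)) (g (S j) - g r) \<le> \<theta> * s\<^sup>2 / 2 * (c S + c (S(j := r)))"
        using mean_value_trace_inequality[OF symY[OF S] symY[OF upd[OF S r]] \<theta>, of s] s[OF SR[OF S] r]
        unfolding Yupd T_def c_def by blast
    qed
    also have "\<dots> = \<theta> * s\<^sup>2 / 2 * ((\<Sum>S\<in>\<Omega>. \<Sum>r\<in>R. c S) + (\<Sum>S\<in>\<Omega>. \<Sum>r\<in>R. c (S(j := r))))"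
      by (simp only: sum_distrib_left[symmetric] sum.distrib)
    \<comment> \<open>A second exchange replaces the copy by the sample, so both \<open>cosh\<close>
      terms have the same sum.\<close>
    also have "(\<Sum>S\<in>\<Omega>. \<Sum>r\<in>R. c (S(j := r))) = (\<Sum>S\<in>\<Omega>. \<Sum>r\<in>R. c S)"
      unfolding \<Omega>_def by (subst sum_PiE_dflt_exchange[OF j, symmetric]) simp
    also have "(\<Sum>S\<in>\<Omega>. \<Sum>r\<in>R. c S) = real (card R) * (\<Sum>S\<in>\<Omega>. c S)"
      by (simp add: sum_distrib_left)
    finally have "real (card R) * (\<Sum>S\<in>\<Omega>. T S (g (S j))) \<le> real (card R) * (s\<^sup>2 / 2 * \<theta> * (\<Sum>S\<in>\<Omega>. c S))"
      unfolding Q1 by (simp add: algebra_simps)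
    then show ?thesis using R by (simp add: card_gt_0_iff)
  qed
  have "(\<Sum>S\<in>\<Omega>. T S (Y S)) = (\<Sum>j\<in>I. \<Sum>S\<in>\<Omega>. T S (g (S j)))"
    unfolding Y_def T_def trace_fun_sum by (rule sum.swap)
  also have "\<dots> \<le> (\<Sum>j\<in>I. s\<^sup>2 / 2 * \<theta> * (\<Sum>S\<in>\<Omega>. c S))" by (intro sum_mono one)
  finally show ?thesis by (simp add: T_def c_def)
qed

text \<open>A Gronwall argument: the derivative \<open>\<Psi>\<close> of \<open>\<Phi>\<close>
  satisfies \<open>\<Psi> t \<le> k * t * \<Phi> t\<close> for \<open>t \<ge> 0\<close>, so
  \<open>\<Phi> t * exp (- (k * t\<^sup>2 / 2))\<close> does not increase from its value at
  \<open>0\<close>. Expectations are kept unnormalized, as sums over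
  \<open>\<Omega>\<close>.\<close>

lemma trace_cosh_bound:
  fixes g :: "'i \<Rightarrow> real^'n^'n" and d :: 'i and I :: "'j set"
  assumes I: "finite I" and R: "finite R" "R \<noteq> {}"
    and sym: "\<And>r. r \<in> R \<Longrightarrow> transpose (g r) = g r" and centered: "(\<Sum>r\<in>R. g r) = 0"
    and s: "\<And>q r x. q \<in> R \<Longrightarrow> r \<in> R \<Longrightarrow> norm ((g q - g r) *v x) \<le> s * norm x" and \<theta>: "\<theta> \<ge> 0"
  defines "\<Omega> \<equiv> PiE_dflt I d (\<lambda>_. R)" and "Y \<equiv> (\<lambda>S. \<Sum>j\<in>I. g (S j))"
  shows "(\<Sum>S\<in>\<Omega>. \<Sum>i\<in>UNIV. cosh (\<theta> * eigval (Y S) i))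
    \<le> real (card \<Omega>) * real CARD('n) * exp (real (card I) * s\<^sup>2 * \<theta>\<^sup>2 / 4)"
proof -
  define \<Phi> where "\<Phi> = (\<lambda>\<theta>. \<Sum>S\<in>\<Omega>. \<Sum>i\<in>UNIV. cosh (\<theta> * eigval (Y S) i))"
  define \<Psi> where "\<Psi> = (\<lambda>\<theta>. \<Sum>S\<in>\<Omega>. \<Sum>i\<in>UNIV. eigval (Y S) i * sinh (\<theta> * eigval (Y S) i))"
  define k where "k = real (card I) * s\<^sup>2 / 2"
  have symY: "transpose (Y S) = Y S" if "S \<in> \<Omega>" for S
    using that unfolding Y_def transpose_sum
    by (intro sum.cong refl sym) (auto simp: \<Omega>_def PiE_dflt_def)
  have \<Psi>_le: "\<Psi> t \<le> k * t * \<Phi> t" if "t \<ge> 0" for t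
  proof -
    have "\<Psi> t = (\<Sum>S\<in>\<Omega>. trace_fun (\<lambda>x. sinh (t * x)) (Y S) (Y S))"
      unfolding \<Psi>_def by (intro sum.cong refl) (simp add: trace_fun_self symY)
    also have "\<dots> \<le> k * t * \<Phi> t"
      unfolding k_def \<Phi>_def \<Omega>_def Y_def by (rule trace_sinh_le_trace_cosh) (use assms that in auto)
    finally show ?thesis .
  qed
  have deriv: "(\<Phi> has_real_derivative \<Psi> t) (at t)" for t
    unfolding \<Phi>_def \<Psi>_def by (auto intro!: derivative_eq_intros simp: mult_ac)
  have "\<Phi> \<theta> * exp (- (k * \<theta>\<^sup>2 / 2)) \<le> \<Phi> 0 * exp (- (k * 0\<^sup>2 / 2))"
  proof (rule DERIV_nonpos_imp_nonincreasing[OF \<theta>])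
    fix t :: real assume t: "0 \<le> t" "t \<le> \<theta>"
    have "((\<lambda>t. \<Phi> t * exp (- (k * t\<^sup>2 / 2))) has_real_derivative
        (\<Psi> t - k * t * \<Phi> t) * exp (- (k * t\<^sup>2 / 2))) (at t)"
      by (auto intro!: derivative_eq_intros deriv simp: algebra_simps)
    moreover have "(\<Psi> t - k * t * \<Phi> t) * exp (- (k * t\<^sup>2 / 2)) \<le> 0"
      using \<Psi>_le[OF t(1)] by (simp add: mult_le_0_iff)
    ultimately show "\<exists>y. ((\<lambda>t. \<Phi> t * exp (- (k * t\<^sup>2 / 2))) has_real_derivative y) (at t) \<and> y \<le> 0"
      by blast
  qed
  then have "\<Phi> \<theta> \<le> \<Phi> 0 * exp (k * \<theta>\<^sup>2 / 2)"
    by (simp add: exp_minus field_simps)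
  moreover have "\<Phi> 0 = real (card \<Omega>) * real CARD('n)" by (simp add: \<Phi>_def)
  ultimately show ?thesis by (simp add: \<Phi>_def k_def mult_ac)
qed

text \<open>Markov's inequality for the trace of \<open>cosh\<close>, counted over
  \<open>\<Omega>\<close>, with the best choice of \<open>\<theta>\<close>.\<close>

theorem matrix_Hoeffding:
  fixes g :: "nat \<Rightarrow> real^'n^'n"
  assumes m: "m > 0" and n: "n > 0" and s: "s > 0" and t: "t \<ge> 0"
    and sym: "\<And>r. r < n \<Longrightarrow> transpose (g r) = g r" and centered: "(\<Sum>r<n. g r) = 0"
    and bound: "\<And>q r x. q < n \<Longrightarrow> r < n \<Longrightarrow> norm ((g q - g r) *v x) \<le> s * norm x"
  shows "measure_pmf.prob (sample_pmf m n) {S. t < spec_norm (\<Sum>j<m. g (S j))}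
    \<le> 2 * real CARD('n) * exp (- (t\<^sup>2 / (real m * s\<^sup>2)))"
proof -
  define \<Omega> where "\<Omega> = PiE_dflt {..<m} (0::nat) (\<lambda>_. {..<n})"
  define Y where "Y = (\<lambda>S::nat \<Rightarrow> nat. \<Sum>j<m. g (S j))"
  have fin: "finite \<Omega>" unfolding \<Omega>_def by (rule finite_PiE_dflt) auto
  have ne: "\<Omega> \<noteq> {}" using n by (auto simp: \<Omega>_def)
  \<comment> \<open>This minimizes the exponent
    \<open>real m * s\<^sup>2 * \<theta>\<^sup>2 / 4 - \<theta> * t\<close>; the minimum is
    \<open>- (t\<^sup>2 / (real m * s\<^sup>2))\<close>.\<close>
  define \<theta> where "\<theta> = 2 * t / (real m * s\<^sup>2)"
  define Bad where "Bad = \<Omega> \<inter> {S. t < spec_norm (Y S)}"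
  have symY: "transpose (Y S) = Y S" if "S \<in> \<Omega>" for S
    using that unfolding Y_def transpose_sum
    by (intro sum.cong refl sym) (auto simp: \<Omega>_def PiE_dflt_def)
  have \<theta>: "\<theta> \<ge> 0" using m s t by (simp add: \<theta>_def)
  \<comment> \<open>One eigenvalue beyond \<open>t\<close> suffices, since \<open>cosh\<close> is
    even, positive and at least half the exponential. The half becomes the factor 2 in the final
    bound.\<close>
  have bad: "exp (\<theta> * t) / 2 \<le> (\<Sum>i\<in>UNIV. cosh (\<theta> * eigval (Y S) i))" if "S \<in> Bad" for S
  proof -
    obtain i where i: "t < \<bar>eigval (Y S) i\<bar>"
      using spec_norm_gt_eigval[OF symY t] \<open>S \<in> Bad\<close> by (auto simp: Bad_def)
    have "exp (\<theta> * t) / 2 \<le> exp (\<theta> * \<bar>eigval (Y S) i\<bar>) / 2"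
      using i \<theta> by (simp add: mult_left_mono)
    also have "\<dots> \<le> cosh (\<theta> * \<bar>eigval (Y S) i\<bar>)" by (simp add: cosh_def)
    also have "\<dots> = cosh (\<theta> * eigval (Y S) i)"
      by (cases "eigval (Y S) i \<ge> 0") auto
    also have "\<dots> \<le> (\<Sum>i\<in>UNIV. cosh (\<theta> * eigval (Y S) i))"
      by (rule member_le_sum) auto
    finally show ?thesis .
  qed
  have "real (card Bad) * (exp (\<theta> * t) / 2) \<le> (\<Sum>S\<in>Bad. \<Sum>i\<in>UNIV. cosh (\<theta> * eigval (Y S) i))"
    using sum_mono[OF bad, of Bad "\<lambda>S. S"] by simp
  also have "\<dots> \<le> (\<Sum>S\<in>\<Omega>. \<Sum>i\<in>UNIV. cosh (\<theta> * eigval (Y S) i))"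
    by (rule sum_mono2[OF fin]) (auto simp: Bad_def intro!: sum_nonneg)
  also have "\<dots> \<le> real (card \<Omega>) * real CARD('n) * exp (real (card {..<m}) * s\<^sup>2 * \<theta>\<^sup>2 / 4)"
    unfolding Y_def \<Omega>_def by (rule trace_cosh_bound) (use n sym centered bound \<theta> in auto)
  finally have "real (card Bad) \<le> real (card \<Omega>) * (2 * real CARD('n) * (exp (real m * s\<^sup>2 * \<theta>\<^sup>2 / 4) * exp (- (\<theta> * t))))"
    by (simp add: exp_minus field_simps)
  also have "exp (real m * s\<^sup>2 * \<theta>\<^sup>2 / 4) * exp (- (\<theta> * t)) = exp (- (t\<^sup>2 / (real m * s\<^sup>2)))"
    unfolding exp_add[symmetric] using m s by (simp add: \<theta>_def power2_eq_square field_simps)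
  finally have "real (card Bad) / real (card \<Omega>) \<le> 2 * real CARD('n) * exp (- (t\<^sup>2 / (real m * s\<^sup>2)))"
    using fin ne by (simp add: field_simps card_gt_0_iff)
  \<comment> \<open>Independent uniform coordinates make the sample uniform on
    \<open>\<Omega>\<close>, so probabilities are ratios of cardinalities.\<close>
  moreover have "sample_pmf m n = pmf_of_set \<Omega>"
    unfolding sample_pmf_def \<Omega>_def by (rule Pi_pmf_of_set) (use n in auto)
  ultimately show ?thesis
    using measure_pmf_of_set[OF ne fin] by (simp add: Bad_def Y_def)
qed

section \<open>Symmetry of the Hessian\<close>

text \<open>The mean value theorem in direction \<open>u\<close> reduces the second difference to a
  difference of gradients at two points, each expanded to first order at \<open>x\<close>.\<close>

lemma second_difference_quotient:
  fixes f :: "real^'n \<Rightarrow> real" and g :: "real^'n \<Rightarrow> real^'n" and A :: "real^'n^'n"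
  assumes D: "open D" "x \<in> D"
    and f: "\<And>y. y \<in> D \<Longrightarrow> (f has_derivative (\<lambda>h. g y \<bullet> h)) (at y)"
    and g: "(g has_derivative (\<lambda>h. A *v h)) (at x)" and e: "e > 0"
  shows "\<exists>d>0. \<forall>t. 0 < t \<and> t < d \<longrightarrow>
    \<bar>f (x + t *\<^sub>R u + t *\<^sub>R v) - f (x + t *\<^sub>R u) - f (x + t *\<^sub>R v) + f x - t\<^sup>2 * (u \<bullet> (A *v v))\<bar> \<le> e * t\<^sup>2"
proof -
  define N where "N = norm u + norm v + 1"
  have N: "N > 0" by (simp add: N_def add_nonneg_pos)
  \<comment> \<open>All points used lie within \<open>t * N\<close> of \<open>x\<close>. Two
    remainders of size \<open>e' * (t * N)\<close>, multiplied by \<open>t * norm u\<close>, then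
    add up to at most \<open>e * t\<^sup>2\<close>.\<close>
  define e' where "e' = e / (2 * N\<^sup>2)"
  have e': "e' > 0" using e N by (simp add: e'_def)
  obtain d1 where d1: "d1 > 0" "\<And>y. norm (y - x) < d1 \<Longrightarrow> norm (g y - g x - A *v (y - x)) \<le> e' * norm (y - x)"
    using g e' unfolding has_derivative_at_alt by blast
  obtain d2 where d2: "d2 > 0" "ball x d2 \<subseteq> D"
    using D openE by blast
  define d where "d = min d1 d2 / N"
  have "d > 0" using d1 d2 N by (simp add: d_def)
  moreover have "\<bar>f (x + t *\<^sub>R u + t *\<^sub>R v) - f (x + t *\<^sub>R u) - f (x + t *\<^sub>R v) + f x - t\<^sup>2 * (u \<bullet> (A *v v))\<bar> \<le> e * t\<^sup>2"
    if t: "0 < t" "t < d" for t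
  proof -
    have tN: "t * N < d1" "t * N < d2" using t N by (simp_all add: d_def field_simps)
    have small: "norm ((s * t) *\<^sub>R u + r *\<^sub>R v) \<le> t * N" if "0 \<le> s" "s \<le> 1" "0 \<le> r" "r \<le> t" for s r
    proof -
      have "norm ((s * t) *\<^sub>R u + r *\<^sub>R v) \<le> (s * t) * norm u + r * norm v"
        using norm_triangle_ineq[of "(s * t) *\<^sub>R u" "r *\<^sub>R v"] that t by simp
      also have "\<dots> \<le> t * norm u + t * norm v"
        using that t by (intro add_mono mult_right_mono) (auto simp: mult_left_le_one_le)
      also have "\<dots> \<le> t * N" using t by (simp add: N_def algebra_simps)
      finally show ?thesis .
    qed
    have inD: "x + ((s * t) *\<^sub>R u + r *\<^sub>R v) \<in> D" if "0 \<le> s" "s \<le> 1" "0 \<le> r" "r \<le> t" for s r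
    proof -
      have "x + ((s * t) *\<^sub>R u + r *\<^sub>R v) \<in> ball x d2"
        using small[OF that] tN by (subst mem_ball, subst dist_commute) (simp add: dist_norm)
      then show ?thesis using d2 by blast
    qed
    have der: "((\<lambda>s. f (x + ((s * t) *\<^sub>R u + r *\<^sub>R v))) has_derivative
        (\<lambda>h. g (x + ((s * t) *\<^sub>R u + r *\<^sub>R v)) \<bullet> ((h * t) *\<^sub>R u))) (at s within S)"
      if "0 \<le> s" "s \<le> 1" "0 \<le> r" "r \<le> t" for s r S
      by (rule has_derivative_compose[where g = f and f = "\<lambda>s. x + ((s * t) *\<^sub>R u + r *\<^sub>R v)",
            OF _ f[OF inD[OF that]]]) (auto intro!: derivative_eq_intros)
    \<comment> \<open>The increment \<open>\<phi> 1 - \<phi> 0\<close> is the mixed second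
      difference.\<close>
    define \<phi> where "\<phi> = (\<lambda>s. f (x + ((s * t) *\<^sub>R u + t *\<^sub>R v)) - f (x + ((s * t) *\<^sub>R u + 0 *\<^sub>R v)))"
    have "\<exists>s\<in>{0<..<1}. \<phi> 1 - \<phi> 0 = g (x + ((s * t) *\<^sub>R u + t *\<^sub>R v)) \<bullet> (((1 - 0) * t) *\<^sub>R u)
        - g (x + ((s * t) *\<^sub>R u + 0 *\<^sub>R v)) \<bullet> (((1 - 0) * t) *\<^sub>R u)"
      unfolding \<phi>_def
      by (rule mvt_simple[OF zero_less_one has_derivative_diff[OF der der]]) (use t in auto)
    then obtain s where s: "0 < s" "s < 1"
      and mvt: "\<phi> 1 - \<phi> 0 = t * (u \<bullet> (g (x + ((s * t) *\<^sub>R u + t *\<^sub>R v)) - g (x + ((s * t) *\<^sub>R u + 0 *\<^sub>R v))))"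
      by (auto simp: inner_diff_right inner_commute right_diff_distrib)
    define a b where "a = (s * t) *\<^sub>R u + t *\<^sub>R v" and "b = (s * t) *\<^sub>R u + 0 *\<^sub>R v"
    have na: "norm a \<le> t * N" and nb: "norm b \<le> t * N"
      unfolding a_def b_def by (rule small; use s t in simp)+
    have ra: "norm (g (x + a) - g x - A *v a) \<le> e' * (t * N)"
    proof -
      have "norm (g (x + a) - g x - A *v a) \<le> e' * norm a" using d1(2)[of "x + a"] na tN by simp
      also have "\<dots> \<le> e' * (t * N)" using na e' by simp
      finally show ?thesis .
    qed
    have rb: "norm (g (x + b) - g x - A *v b) \<le> e' * (t * N)"
    proof -
      have "norm (g (x + b) - g x - A *v b) \<le> e' * norm b" using d1(2)[of "x + b"] nb tN by simp
      also have "\<dots> \<le> e' * (t * N)" using nb e' by simp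
      finally show ?thesis .
    qed
    have "A *v a = A *v b + t *\<^sub>R (A *v v)"
      by (simp add: a_def b_def matrix_vector_right_distrib matrix_vector_mult_scaleR)
    then have "(g (x + a) - g x - A *v a) - (g (x + b) - g x - A *v b) = g (x + a) - g (x + b) - t *\<^sub>R (A *v v)"
      by simp
    then have "\<phi> 1 - \<phi> 0 - t\<^sup>2 * (u \<bullet> (A *v v))
        = t * (u \<bullet> ((g (x + a) - g x - A *v a) - (g (x + b) - g x - A *v b)))"
      unfolding mvt a_def[symmetric] b_def[symmetric]
      by (simp only: inner_diff_right inner_scaleR_right power2_eq_square right_diff_distrib mult.assoc)
    also have "\<bar>\<dots>\<bar> \<le> t * (norm u * (e' * (t * N) + e' * (t * N)))"
    proof -
      have "\<bar>u \<bullet> ((g (x + a) - g x - A *v a) - (g (x + b) - g x - A *v b))\<bar>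
          \<le> norm u * norm ((g (x + a) - g x - A *v a) - (g (x + b) - g x - A *v b))"
        by (rule Cauchy_Schwarz_ineq2)
      also have "\<dots> \<le> norm u * (e' * (t * N) + e' * (t * N))"
        by (intro mult_left_mono order_trans[OF norm_triangle_ineq4] add_mono ra rb) simp
      finally show ?thesis using t by (simp add: abs_mult)
    qed
    also have "\<dots> \<le> t * (N * (e' * (t * N) + e' * (t * N)))"
      using t N e' by (intro mult_left_mono mult_right_mono) (auto simp: N_def)
    also have "\<dots> = e * t\<^sup>2" using N by (simp add: e'_def power2_eq_square field_simps)
    finally show ?thesis by (simp add: \<phi>_def add.assoc algebra_simps)
  qed
  ultimately show ?thesis by blast
qed

text \<open>The mixed second difference is symmetric in \<open>u\<close> and \<open>v\<close>, while
  its quotient by \<open>t\<^sup>2\<close> tends to \<open>u \<bullet> (A *v v)\<close> and also to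
  \<open>v \<bullet> (A *v u)\<close>.\<close>

theorem hessian_symmetric:
  fixes f :: "real^'n \<Rightarrow> real" and g :: "real^'n \<Rightarrow> real^'n" and A :: "real^'n^'n"
  assumes D: "open D" "x \<in> D"
    and f: "\<And>y. y \<in> D \<Longrightarrow> (f has_derivative (\<lambda>h. g y \<bullet> h)) (at y)"
    and g: "(g has_derivative (\<lambda>h. A *v h)) (at x)"
  shows "transpose A = A"
proof -
  have le: "\<bar>u \<bullet> (A *v v) - v \<bullet> (A *v u)\<bar> \<le> e" if e: "e > 0" for u v e
  proof -
    obtain d1 where d1: "d1 > 0" "\<And>t. 0 < t \<Longrightarrow> t < d1 \<Longrightarrow>
      \<bar>f (x + t *\<^sub>R u + t *\<^sub>R v) - f (x + t *\<^sub>R u) - f (x + t *\<^sub>R v) + f x - t\<^sup>2 * (u \<bullet> (A *v v))\<bar> \<le> e / 2 * t\<^sup>2"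
      using second_difference_quotient[OF D f g, of "e / 2" u v] e by auto
    obtain d2 where d2: "d2 > 0" "\<And>t. 0 < t \<Longrightarrow> t < d2 \<Longrightarrow>
      \<bar>f (x + t *\<^sub>R v + t *\<^sub>R u) - f (x + t *\<^sub>R v) - f (x + t *\<^sub>R u) + f x - t\<^sup>2 * (v \<bullet> (A *v u))\<bar> \<le> e / 2 * t\<^sup>2"
      using second_difference_quotient[OF D f g, of "e / 2" v u] e by auto
    define t where "t = min d1 d2 / 2"
    have t: "0 < t" "t < d1" "t < d2" using d1 d2 by (auto simp: t_def)
    have "\<bar>t\<^sup>2 * (u \<bullet> (A *v v)) - t\<^sup>2 * (v \<bullet> (A *v u))\<bar> \<le> e / 2 * t\<^sup>2 + e / 2 * t\<^sup>2"
      using d1(2)[of t] d2(2)[of t] t unfolding add.assoc[of x] add.commute[of "t *\<^sub>R v" "t *\<^sub>R u"]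
      by linarith
    then have "t\<^sup>2 * \<bar>u \<bullet> (A *v v) - v \<bullet> (A *v u)\<bar> \<le> t\<^sup>2 * e"
      by (simp add: right_diff_distrib[symmetric] abs_mult mult.commute[of e])
    then show ?thesis using t by simp
  qed
  have "u \<bullet> (A *v v) = v \<bullet> (A *v u)" for u v
    using field_le_epsilon[of "\<bar>u \<bullet> (A *v v) - v \<bullet> (A *v u)\<bar>" 0] le by auto
  then have "(transpose A *v u) \<bullet> v = (A *v u) \<bullet> v" for u v
    by (metis dot_lmul_matrix transpose_matrix_vector inner_commute)
  then have "transpose A *v u = A *v u" for u
    by (metis vector_eq_rdot)
  then show ?thesis by (simp add: matrix_eq)
qed

section \<open>The Newton step\<close>

text \<open>If the derivative towards \<open>x\<close> were negative, a short step along the segment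
  would stay in \<open>C\<close> and decrease \<open>\<phi>\<close>.\<close>

lemma convex_local_min_directional:
  fixes \<phi> :: "'a::real_normed_vector \<Rightarrow> real"
  assumes C: "convex C" "z \<in> C" "x \<in> C" and der: "(\<phi> has_derivative \<phi>') (at z)"
    and min: "\<exists>e>0. \<forall>y\<in>C. dist y z < e \<longrightarrow> \<phi> z \<le> \<phi> y"
  shows "0 \<le> \<phi>' (x - z)"
proof (rule ccontr)
  assume neg: "\<not> 0 \<le> \<phi>' (x - z)"
  define \<psi> where "\<psi> = (\<lambda>t. \<phi> (z + t *\<^sub>R (x - z)))"
  have "(\<psi> has_derivative (\<lambda>t. \<phi>' (t *\<^sub>R (x - z)))) (at 0)"
    unfolding \<psi>_def
    by (rule has_derivative_compose[where g = \<phi> and f = "\<lambda>t. z + t *\<^sub>R (x - z)"])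
      (auto intro!: derivative_eq_intros der)
  moreover have "(\<lambda>t. \<phi>' (t *\<^sub>R (x - z))) = (*) (\<phi>' (x - z))"
    using linear_scale[OF has_derivative_linear[OF der]] by (auto simp: mult.commute)
  ultimately have "(\<psi> has_real_derivative \<phi>' (x - z)) (at 0)"
    by (simp only: has_field_derivative_def)
  then obtain d where d: "d > 0" "\<And>h. 0 < h \<Longrightarrow> h < d \<Longrightarrow> \<psi> h < \<psi> 0"
    using neg DERIV_neg_dec_right[of \<psi> "\<phi>' (x - z)" 0] by auto
  obtain e where e: "e > 0" "\<And>y. y \<in> C \<Longrightarrow> dist y z < e \<Longrightarrow> \<phi> z \<le> \<phi> y" using min by blast
  define r where "r = e / (norm (x - z) + 1)"
  \<comment> \<open>The step is below \<open>d\<close> for the decrease, below \<open>1\<close> for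
    convexity and below \<open>r\<close> to stay in the ball of local minimality.\<close>
  define h where "h = min (min d 1) r / 2"
  have pos: "norm (x - z) + 1 > 0" by (simp add: add_nonneg_pos)
  then have "r > 0" using e by (simp add: r_def)
  then have h: "0 < h" "h < d" "h < 1" "h < r"
    using d by (auto simp: h_def min_def)
  have "h * norm (x - z) \<le> h * (norm (x - z) + 1)" using h by simp
  also have "\<dots> < e" using h(4) pos by (simp add: r_def pos_less_divide_eq)
  finally have "dist (z + h *\<^sub>R (x - z)) z < e" using h by (simp add: dist_norm)
  moreover have "z + h *\<^sub>R (x - z) \<in> C"
    using convexD_alt[OF C, of h] h by (simp add: algebra_simps)
  ultimately have "\<phi> z \<le> \<psi> h" unfolding \<psi>_def by (intro e)
  then show False using d(2)[OF h(1,2)] by (simp add: \<psi>_def)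
qed

text \<open>Along the segment from \<open>z\<close> to \<open>x\<close> the linear part is
  subtracted from \<open>g\<close>. The remainder \<open>G\<close> has speed at most
  \<open>L * t * (norm d)\<^sup>2\<close>, and integrating \<open>t\<close> over the unit interval
  gives the factor 1/2.\<close>

lemma gradient_linearization_error:
  fixes g :: "real^'n \<Rightarrow> real^'n" and A :: "real^'n \<Rightarrow> real^'n^'n"
  assumes C: "convex C" "z \<in> C" "x \<in> C"
    and g: "\<And>y. y \<in> C \<Longrightarrow> (g has_derivative (\<lambda>h. A y *v h)) (at y)"
    and lip: "\<And>y. y \<in> C \<Longrightarrow> spec_norm (A y - A z) \<le> L * norm (y - z)"
  shows "norm (g x - g z - A z *v (x - z)) \<le> L / 2 * (norm (x - z))\<^sup>2"
proof -
  define d where "d = x - z"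
  have inC: "z + t *\<^sub>R d \<in> C" if "0 \<le> t" "t \<le> 1" for t
    using convexD_alt[OF C, of t] that by (simp add: d_def algebra_simps)
  define G where "G = (\<lambda>t. g (z + t *\<^sub>R d) - t *\<^sub>R (A z *v d))"
  have G: "(G has_vector_derivative ((A (z + t *\<^sub>R d) - A z) *v d)) (at t)" if "0 \<le> t" "t \<le> 1" for t
  proof -
    have "((\<lambda>t. g (z + t *\<^sub>R d)) has_derivative (\<lambda>h. A (z + t *\<^sub>R d) *v (h *\<^sub>R d))) (at t)"
      by (rule has_derivative_compose[where g = g and f = "\<lambda>t. z + t *\<^sub>R d", OF _ g[OF inC[OF that]]])
        (auto intro!: derivative_eq_intros)
    then have "((\<lambda>t. g (z + t *\<^sub>R d)) has_vector_derivative (A (z + t *\<^sub>R d) *v d)) (at t)"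
      by (simp add: has_vector_derivative_def matrix_vector_mult_scaleR)
    then show ?thesis
      unfolding G_def by (auto intro!: derivative_eq_intros simp: matrix_vector_mult_diff_rdistrib)
  qed
  have "norm (G 1 - G 0) \<le> L / 2 * (norm d)\<^sup>2 * 1\<^sup>2 - L / 2 * (norm d)\<^sup>2 * 0\<^sup>2"
  proof (rule differentiable_bound_general[OF zero_less_one, where \<phi>' = "\<lambda>t. L * t * (norm d)\<^sup>2"])
    show "continuous_on {0..1} G"
      by (rule continuous_at_imp_continuous_on) (use has_vector_derivative_continuous[OF G] in auto)
    show "continuous_on {0..1} (\<lambda>t. L / 2 * (norm d)\<^sup>2 * t\<^sup>2)" by (intro continuous_intros)
    fix t :: real assume t: "0 < t" "t < 1"
    show "(G has_vector_derivative ((A (z + t *\<^sub>R d) - A z) *v d)) (at t)" using G t by simp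
    show "((\<lambda>t. L / 2 * (norm d)\<^sup>2 * t\<^sup>2) has_vector_derivative L * t * (norm d)\<^sup>2) (at t)"
      unfolding has_real_derivative_iff_has_vector_derivative[symmetric]
      by (auto intro!: derivative_eq_intros)
    have "norm ((A (z + t *\<^sub>R d) - A z) *v d) \<le> spec_norm (A (z + t *\<^sub>R d) - A z) * norm d"
      by (rule spec_norm_le)
    also have "\<dots> \<le> L * norm (t *\<^sub>R d) * norm d"
      using lip[OF inC[of t]] t by (intro mult_right_mono) auto
    also have "\<dots> = L * t * (norm d)\<^sup>2" using t by (simp add: power2_eq_square)
    finally show "norm ((A (z + t *\<^sub>R d) - A z) *v d) \<le> L * t * (norm d)\<^sup>2" .
  qed
  then show ?thesis by (simp add: G_def d_def algebra_simps)
qed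

lemma spec_norm_average:
  fixes A :: "nat \<Rightarrow> real^'n^'n"
  assumes m: "m > 0" and A: "\<And>j. j < m \<Longrightarrow> spec_norm (A j) \<le> c"
  shows "spec_norm ((1 / real m) *\<^sub>R (\<Sum>j<m. A j)) \<le> c"
proof (rule spec_norm_least)
  fix x
  have "(\<Sum>j<k. A j) *v x = (\<Sum>j<k. A j *v x)" for k
    by (induction k) (simp_all add: matrix_vector_mult_add_rdistrib)
  then have "norm (((1 / real m) *\<^sub>R (\<Sum>j<m. A j)) *v x) = norm (\<Sum>j<m. A j *v x) / real m"
    by (simp add: scaleR_matrix_vector_assoc[symmetric])
  also have "norm (\<Sum>j<m. A j *v x) \<le> (\<Sum>j<m. c * norm x)"
    by (intro sum_norm_le order_trans[OF spec_norm_le] mult_right_mono A) auto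
  finally show "norm (((1 / real m) *\<^sub>R (\<Sum>j<m. A j)) *v x) \<le> c * norm x"
    using m by (simp add: divide_right_mono)
qed

lemma transpose_average:
  fixes A :: "nat \<Rightarrow> real^'n^'n"
  assumes "\<And>j. j < m \<Longrightarrow> transpose (A j) = A j"
  shows "transpose ((1 / real m) *\<^sub>R (\<Sum>j<m. A j)) = (1 / real m) *\<^sub>R (\<Sum>j<m. A j)"
proof -
  have "transpose ((1 / real m) *\<^sub>R (\<Sum>j<m. A j)) = (1 / real m) *\<^sub>R (\<Sum>j<m. transpose (A j))"
    by (simp add: transpose_def vec_eq_iff)
  then show ?thesis using assms by simp
qed

text \<open>The variational inequality at \<open>y\<close> towards \<open>xs\<close> is added to the
  assumed one at \<open>xs\<close> towards \<open>y\<close>; coercivity of \<open>M\<close> and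
  Cauchy-Schwarz then bound the error.\<close>

lemma newton_step_bound:
  fixes M :: "real^'n^'n"
  assumes C: "convex C" "xs \<in> C" "y \<in> C"
    and M: "\<And>u v. u \<bullet> (M *v v) = v \<bullet> (M *v u)" "\<And>u. lam * (norm u)\<^sup>2 \<le> u \<bullet> (M *v u)"
    and y: "\<And>x. x \<in> C \<Longrightarrow> (y - xk) \<bullet> g + (1 / 2) * ((y - xk) \<bullet> (M *v (y - xk)))
      \<le> (x - xk) \<bullet> g + (1 / 2) * ((x - xk) \<bullet> (M *v (x - xk)))"
    and xs: "0 \<le> (y - xs) \<bullet> gs"
  shows "lam * norm (y - xs) \<le> norm (M *v (xk - xs) - (g - gs))"
proof (cases "y = xs")
  case False
  define q where "q = (\<lambda>x. (x - xk) \<bullet> g + (1 / 2) * ((x - xk) \<bullet> (M *v (x - xk))))"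
  have M': "((\<lambda>x. M *v (x - xk)) has_derivative (\<lambda>h. M *v h)) (at y)"
    by (rule bounded_linear.has_derivative[OF matrix_vector_mul_bounded_linear,
          where g = "\<lambda>x. x - xk" and g' = "\<lambda>h. h"])
      (auto intro!: derivative_eq_intros)
  have id': "((\<lambda>x. x - xk) has_derivative (\<lambda>h. h)) (at y)"
    by (auto intro!: derivative_eq_intros)
  have "(q has_derivative (\<lambda>h. h \<bullet> g + (1 / 2) * ((y - xk) \<bullet> (M *v h) + h \<bullet> (M *v (y - xk))))) (at y)"
    unfolding q_def
    by (intro has_derivative_add has_derivative_mult_right has_derivative_inner_left
        has_derivative_inner[OF id' M'] id')
  then have "(q has_derivative (\<lambda>h. h \<bullet> g + h \<bullet> (M *v (y - xk)))) (at y)"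
    by (simp add: M(1)[of "y - xk"])
  then have "0 \<le> (xs - y) \<bullet> g + (xs - y) \<bullet> (M *v (y - xk))"
    by (rule convex_local_min_directional[OF C(1,3,2)]) (use y zero_less_one in \<open>unfold q_def, blast\<close>)
  moreover define e where "e = y - xs"
  ultimately have "e \<bullet> (M *v (y - xk)) \<le> - (e \<bullet> g)"
    by (simp add: inner_diff_left)
  moreover have "M *v e = M *v (y - xk) + M *v (xk - xs)"
    by (simp add: e_def matrix_vector_right_distrib[symmetric])
  ultimately have "e \<bullet> (M *v e) \<le> e \<bullet> (M *v (xk - xs) - (g - gs))"
    using xs by (simp add: e_def[symmetric] inner_add_right inner_diff_right)
  also have "\<dots> \<le> norm e * norm (M *v (xk - xs) - (g - gs))" by (rule norm_cauchy_schwarz)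
  finally have "norm e * (lam * norm e) \<le> norm e * norm (M *v (xk - xs) - (g - gs))"
    using M(2)[of e] by (simp add: power2_eq_square mult_ac)
  moreover have "norm e > 0" using False by (simp add: e_def)
  ultimately show ?thesis by (simp add: e_def)
qed simp

text \<open>The implication is asked on the support only, because that is where all drawn indices
  are known to be valid.\<close>

lemma prob_ge_on_support:
  assumes "measure_pmf.prob p B \<le> \<delta>" "\<And>S. S \<in> set_pmf p \<Longrightarrow> S \<notin> B \<Longrightarrow> S \<in> A"
  shows "measure_pmf.prob p A \<ge> 1 - \<delta>"
proof -
  have "measure_pmf.prob p (- B) \<le> measure_pmf.prob p A"
    by (rule measure_pmf.finite_measure_mono_AE)
      (use assms(2) in \<open>auto simp: AE_measure_pmf_iff\<close>)
  moreover have "measure_pmf.prob p (- B) = 1 - measure_pmf.prob p B"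
    using measure_pmf.prob_compl[of B p] by (simp add: Compl_eq_Diff_UNIV)
  ultimately show ?thesis using assms(1) by simp
qed

theorem theorem6:
  fixes f :: "nat \<Rightarrow> real^'p \<Rightarrow> real"
    and grad :: "nat \<Rightarrow> real^'p \<Rightarrow> real^'p"
    and hess :: "nat \<Rightarrow> real^'p \<Rightarrow> real^'p^'p"
    and n m :: nat and D X :: "(real^'p) set"
    and xstar xk :: "real^'p"
    and \<delta> \<epsilon> lam L :: real
  defines "F \<equiv> (\<lambda>x. (1 / real n) * (\<Sum>i<n. f i x))"
    and "gradF \<equiv> (\<lambda>x. (1 / real n) *\<^sub>R (\<Sum>i<n. grad i x))"
    and "Kstar \<equiv> Max ((\<lambda>i. spec_norm (hess i xstar)) ` {..<n})"
    and "\<gamma>star \<equiv> lambda_min ((1 / real n) *\<^sub>R (\<Sum>i<n. hess i xstar))"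
  assumes n_pos: "n > 0"
    and D_open: "open D" and D_convex: "convex D" and X_convex: "convex X"
    and grad_f: "\<And>i x. i < n \<Longrightarrow> x \<in> D \<Longrightarrow> (f i has_derivative (\<lambda>h. grad i x \<bullet> h)) (at x)"
    and hess_f: "\<And>i x. i < n \<Longrightarrow> x \<in> D \<Longrightarrow> (grad i has_derivative (\<lambda>h. hess i x *v h)) (at x)"
    and xstar_in: "xstar \<in> D \<inter> X"
    and local_min: "\<exists>e>0. \<forall>x\<in>D \<inter> X. dist x xstar < e \<longrightarrow> F xstar \<le> F x"
    and L_pos: "L > 0"
    and LipS: "\<And>i x. i < n \<Longrightarrow> x \<in> D \<inter> X \<Longrightarrow>
                  spec_norm (hess i x - hess i xstar) \<le> L * norm (x - xstar)"
    and SCS: "\<gamma>star > 0"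
    and delta: "0 < \<delta>" "\<delta> < 1" and eps: "0 < \<epsilon>" "\<epsilon> < 1" and lam_pos: "lam > 0"
    and xk_in: "xk \<in> D \<inter> X"
    and m_ge: "real m \<ge> 16 * Kstar\<^sup>2 * ln (2 * real CARD('p) / \<delta>) / (\<gamma>star\<^sup>2 * \<epsilon>\<^sup>2)"
    and lam_ge: "lam \<ge> (1 - \<epsilon>) * \<gamma>star"
  shows "measure_pmf.prob (sample_pmf m n)
           {S. \<forall>y. (y \<in> D \<inter> X \<and>
                    (\<forall>x\<in>D \<inter> X.
                       F xk + (y - xk) \<bullet> gradF xk
                         + (1 / (2 * 1)) * ((y - xk) \<bullet> (spec_reg lam (subH hess m S xk) *v (y - xk)))
                       \<le> F xk + (x - xk) \<bullet> gradF xk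
                         + (1 / (2 * 1)) * ((x - xk) \<bullet> (spec_reg lam (subH hess m S xk) *v (x - xk)))))
                \<longrightarrow> norm (y - xstar)
                      \<le> ((lam - (1 - \<epsilon>) * \<gamma>star + \<gamma>star * \<epsilon>) / lam) * norm (xk - xstar)
                        + ((sqrt (real CARD('p)) + 1 / 2) * L / lam) * (norm (xk - xstar))\<^sup>2}
         \<ge> 1 - \<delta>"
proof -
  let ?N = "real CARD('p)"
  define C where "C = D \<inter> X"
  define A where "A = (\<lambda>x. (1 / real n) *\<^sub>R (\<Sum>i<n. hess i x))"
  define \<gamma> where "\<gamma> = \<gamma>star"
  define K where "K = Kstar"
  have C: "convex C" "xstar \<in> C" "xk \<in> C"
    using D_convex X_convex xstar_in xk_in by (simp_all add: C_def convex_Int)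
  have CD: "x \<in> D" if "x \<in> C" for x using that by (simp add: C_def)
  have sym: "transpose (hess i x) = hess i x" if "i < n" "x \<in> C" for i x
    by (rule hessian_symmetric[OF D_open CD[OF that(2)] grad_f[OF that(1)] hess_f[OF that(1) CD[OF that(2)]]])
  have symA: "transpose (A x) = A x" if "x \<in> C" for x
    unfolding A_def by (rule transpose_average) (use sym that in auto)
  have \<gamma>_pos: "\<gamma> > 0" using SCS by (simp add: \<gamma>_def)
  have \<gamma>_le: "\<gamma> * (norm x)\<^sup>2 \<le> x \<bullet> (A xstar *v x)" for x
    using lambda_min_quadratic[OF symA[OF C(2)], of x] by (simp add: \<gamma>_def \<gamma>star_def A_def)
  have K: "spec_norm (hess i xstar) \<le> K" if "i < n" for i
    unfolding K_def Kstar_def by (rule Max_ge) (use that in auto)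
  \<comment> \<open>The smallest eigenvalue of an average is at most the largest norm of its
    members, so \<open>0 < \<gamma> \<le> K\<close>. This makes the required sample size
    positive.\<close>
  have K_pos: "K > 0"
  proof -
    obtain x :: "real^'p" where x: "norm x = 1" using vector_choose_size[of 1] by auto
    have "\<gamma> \<le> x \<bullet> (A xstar *v x)" using \<gamma>_le[of x] x by simp
    also have "\<dots> \<le> norm x * norm (A xstar *v x)" by (rule norm_cauchy_schwarz)
    also have "\<dots> \<le> spec_norm (A xstar)" using spec_norm_le[of "A xstar" x] x by simp
    also have "\<dots> \<le> K" unfolding A_def by (rule spec_norm_average) (use n_pos K in auto)
    finally show ?thesis using \<gamma>_pos by simp
  qed
  have ln_pos: "ln (2 * ?N / \<delta>) > 0"
  proof -
    have "?N \<ge> 1" by (simp add: Suc_leI)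
    then have "\<delta> < 2 * ?N" using delta by linarith
    then show ?thesis using delta by simp
  qed
  have m_ge': "16 * K\<^sup>2 * ln (2 * ?N / \<delta>) / (\<gamma>\<^sup>2 * \<epsilon>\<^sup>2) \<le> real m"
    using m_ge by (simp add: K_def \<gamma>_def)
  have "0 < 16 * K\<^sup>2 * ln (2 * ?N / \<delta>) / (\<gamma>\<^sup>2 * \<epsilon>\<^sup>2)"
    using K_pos \<gamma>_pos eps ln_pos by simp
  then have m: "m > 0" using m_ge' by linarith

  \<comment> \<open>Concentration of the sub-sampled Hessian at \<open>xstar\<close>\<close>
  define g where "g = (\<lambda>r. hess r xstar - A xstar)"
  have symg: "transpose (g r) = g r" if "r < n" for r
    using sym[OF that C(2)] symA[OF C(2)] by (simp add: g_def transpose_def vec_eq_iff)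
  have centered: "(\<Sum>r<n. g r) = 0"
    using n_pos by (simp add: g_def A_def sum_subtractf sum_constant_scaleR del: sum_constant)
  \<comment> \<open>Two Hessians of norm at most \<open>K\<close> differ by at most
    \<open>2 * K\<close>, which serves as the range \<open>s\<close> in the Hoeffding bound.\<close>
  have bound: "norm ((g q - g r) *v x) \<le> (2 * K) * norm x" if "q < n" "r < n" for q r x
  proof -
    have "norm ((g q - g r) *v x) \<le> norm (hess q xstar *v x) + norm (hess r xstar *v x)"
      using norm_triangle_ineq4[of "hess q xstar *v x" "hess r xstar *v x"]
      by (simp add: g_def matrix_vector_mult_diff_rdistrib)
    also have "\<dots> \<le> K * norm x + K * norm x"
      by (intro add_mono order_trans[OF spec_norm_le] mult_right_mono K that) auto
    finally show ?thesis by simp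
  qed
  \<comment> \<open>A deviation \<open>\<epsilon> * \<gamma>\<close> of the average is a deviation
    \<open>t\<close> of the sum of \<open>m\<close> terms.\<close>
  define t where "t = real m * (\<epsilon> * \<gamma>)"
  have "measure_pmf.prob (sample_pmf m n) {S. t < spec_norm (\<Sum>j<m. g (S j))}
      \<le> 2 * ?N * exp (- (t\<^sup>2 / (real m * (2 * K)\<^sup>2)))"
    by (rule matrix_Hoeffding) (use m n_pos K_pos eps \<gamma>_pos symg centered bound in \<open>auto simp: t_def\<close>)
  also have "\<dots> \<le> 2 * ?N * exp (- ln (2 * ?N / \<delta>))"
  proof -
    \<comment> \<open>The sample size makes the exponent at least
      \<open>4 * ln (2 * ?N / \<delta>)\<close>; the exponential then cancels the prefactor
      \<open>2 * ?N\<close> and leaves \<open>\<delta>\<close>.\<close>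
    have "16 * K\<^sup>2 * ln (2 * ?N / \<delta>) \<le> real m * (\<gamma>\<^sup>2 * \<epsilon>\<^sup>2)"
      using m_ge' \<gamma>_pos eps by (simp add: pos_divide_le_eq)
    then have "4 * ln (2 * ?N / \<delta>) \<le> real m * (\<gamma>\<^sup>2 * \<epsilon>\<^sup>2) / (4 * K\<^sup>2)"
      using K_pos by (simp add: pos_le_divide_eq mult_ac)
    also have "\<dots> = t\<^sup>2 / (real m * (2 * K)\<^sup>2)"
      using m by (simp add: t_def power2_eq_square)
    finally show ?thesis using ln_pos by simp
  qed
  also have "\<dots> = \<delta>" using delta by (simp add: exp_minus)
  finally have bad: "measure_pmf.prob (sample_pmf m n) {S. t < spec_norm (\<Sum>j<m. g (S j))} \<le> \<delta>" .

  \<comment> \<open>On the support every drawn index is below \<open>n\<close>, so the assumptions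
    on the Hessians apply to it; the default value \<open>0\<close> only concerns coordinates from
    \<open>m\<close> on.\<close>
  have supp: "S j < n" if "S \<in> set_pmf (sample_pmf m n)" "j < m" for S j
  proof -
    have "S \<in> PiE_dflt {..<m} 0 (set_pmf \<circ> (\<lambda>_. pmf_of_set {..<n}))"
      using that(1) set_Pi_pmf_subset'[OF finite_lessThan[of m], of 0 "\<lambda>_. pmf_of_set {..<n}"]
      unfolding sample_pmf_def by blast
    then show ?thesis using that(2) n_pos by (auto simp: PiE_dflt_def set_pmf_of_set lessThan_empty_iff)
  qed

  \<comment> \<open>Derivatives of the averaged objective and stationarity\<close>
  have derF: "(F has_derivative (\<lambda>h. gradF x \<bullet> h)) (at x)" if "x \<in> C" for x
    unfolding F_def gradF_def
    using has_derivative_mult_right[OF has_derivative_sum[of "{..<n}" f "\<lambda>i h. grad i x \<bullet> h" "at x"], of "1 / real n"]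
      grad_f CD[OF that] by (simp add: inner_sum_left)
  have derG: "(gradF has_derivative (\<lambda>h. A x *v h)) (at x)" if "x \<in> C" for x
  proof -
    have sum_mv: "(\<Sum>i<k. hess i x) *v h = (\<Sum>i<k. hess i x *v h)" for k h
      by (induction k) (simp_all add: matrix_vector_mult_add_rdistrib)
    show ?thesis
      unfolding gradF_def A_def
      using has_derivative_scaleR_right[OF has_derivative_sum[of "{..<n}" grad "\<lambda>i h. hess i x *v h" "at x"], of "1 / real n"]
        hess_f CD[OF that] by (simp add: scaleR_matrix_vector_assoc[symmetric] sum_mv)
  qed
  define d where "d = norm (xk - xstar)"
  have lipA: "spec_norm (A x - A xstar) \<le> L * norm (x - xstar)" if "x \<in> C" for x
  proof -
    have "A x - A xstar = (1 / real n) *\<^sub>R (\<Sum>i<n. hess i x - hess i xstar)"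
      by (simp add: A_def sum_subtractf scaleR_diff_right)
    then show ?thesis
      using spec_norm_average[of n "\<lambda>i. hess i x - hess i xstar"] n_pos LipS that by (simp add: C_def)
  qed
  have lin: "norm (gradF xk - gradF xstar - A xstar *v (xk - xstar)) \<le> L / 2 * d\<^sup>2"
    unfolding d_def by (rule gradient_linearization_error[OF C derG lipA])
  \<comment> \<open>Although \<open>xstar\<close> is only a local minimum, the first-order
    inequality holds towards every point of the convex set \<open>C\<close>.\<close>
  have opt: "0 \<le> (x - xstar) \<bullet> gradF xstar" if "x \<in> C" for x
    using convex_local_min_directional[OF C(1,2) that derF[OF C(2)]] local_min
    by (simp add: inner_commute C_def)

  \<comment> \<open>Deterministic error bound on the good event\<close>
  have main: "norm (y - xstar) \<le> ((lam - (1 - \<epsilon>) * \<gamma> + \<gamma> * \<epsilon>) / lam) * d + ((sqrt ?N + 1 / 2) * L / lam) * d\<^sup>2"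
    if S: "\<And>j. j < m \<Longrightarrow> S j < n" and good: "spec_norm (\<Sum>j<m. g (S j)) \<le> t" and y: "y \<in> C"
      and ymin: "\<And>x. x \<in> C \<Longrightarrow>
        (y - xk) \<bullet> gradF xk + (1 / 2) * ((y - xk) \<bullet> (spec_reg lam (subH hess m S xk) *v (y - xk)))
        \<le> (x - xk) \<bullet> gradF xk + (1 / 2) * ((x - xk) \<bullet> (spec_reg lam (subH hess m S xk) *v (x - xk)))"
    for S y
  proof -
    define H Hs where "H = subH hess m S xk" and "Hs = subH hess m S xstar"
    have symH: "transpose H = H" and symHs: "transpose Hs = Hs"
      unfolding H_def Hs_def subH_def by (rule transpose_average; use sym S C in auto)+
    define v where "v = xk - xstar"
    have dv: "norm v = d" by (simp add: v_def d_def)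
    have dev: "norm (Hs *v x - A xstar *v x) \<le> \<epsilon> * \<gamma> * norm x" for x
    proof -
      have "(\<Sum>j<m. g (S j)) = real m *\<^sub>R (Hs - A xstar)"
        using m by (simp add: g_def Hs_def subH_def sum_subtractf scaleR_diff_right sum_constant_scaleR del: sum_constant)
      then have "real m * norm ((Hs - A xstar) *v x) = norm ((\<Sum>j<m. g (S j)) *v x)"
        by (simp add: scaleR_matrix_vector_assoc[symmetric])
      also have "\<dots> \<le> t * norm x"
        by (rule order_trans[OF spec_norm_le mult_right_mono[OF good]]) simp
      finally have "real m * norm ((Hs - A xstar) *v x) \<le> real m * (\<epsilon> * \<gamma> * norm x)"
        by (simp add: t_def mult_ac)
      then show ?thesis using m by (simp add: matrix_vector_mult_diff_rdistrib)
    qed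
    \<comment> \<open>A perturbation of norm \<open>\<epsilon> * \<gamma>\<close> lowers the bound
      \<open>\<gamma>\<close> on the quadratic form to \<open>(1 - \<epsilon>) * \<gamma>\<close>,
      which is the constant \<open>c\<close> in the clipping estimate.\<close>
    have lower: "((1 - \<epsilon>) * \<gamma>) * (norm x)\<^sup>2 \<le> x \<bullet> (Hs *v x)" for x
    proof -
      have "x \<bullet> (A xstar *v x) - x \<bullet> (Hs *v x) \<le> norm x * norm (A xstar *v x - Hs *v x)"
        unfolding inner_diff_right[symmetric] by (rule norm_cauchy_schwarz)
      also have "\<dots> \<le> norm x * (\<epsilon> * \<gamma> * norm x)"
        using dev[of x] by (intro mult_left_mono) (simp_all add: norm_minus_commute)
      finally show ?thesis using \<gamma>_le[of x] by (simp add: algebra_simps power2_eq_square)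
    qed
    have HHs: "spec_norm (H - Hs) \<le> L * d"
    proof -
      have "H - Hs = (1 / real m) *\<^sub>R (\<Sum>j<m. hess (S j) xk - hess (S j) xstar)"
        by (simp add: H_def Hs_def subH_def sum_subtractf scaleR_diff_right)
      then show ?thesis
        using spec_norm_average[of m "\<lambda>j. hess (S j) xk - hess (S j) xstar"] m LipS S C(3)
        by (simp add: C_def d_def)
    qed
    have "lam * norm (y - xstar) \<le> norm (spec_reg lam H *v v - (gradF xk - gradF xstar))"
      unfolding v_def
      by (rule newton_step_bound[OF C(1,2) y spec_reg_commute[OF symH] spec_reg_lower[OF symH] ymin[folded H_def] opt[OF y]])
    \<comment> \<open>The two middle differences give the terms linear in \<open>d\<close>, the
      first and the last give the quadratic ones.\<close>
    also have "spec_reg lam H *v v - (gradF xk - gradF xstar) =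
        (spec_reg lam H *v v - spec_reg lam Hs *v v) + ((spec_reg lam Hs *v v - Hs *v v)
        + ((Hs *v v - A xstar *v v) + (A xstar *v v - (gradF xk - gradF xstar))))" by simp
    also have "norm \<dots> \<le> sqrt ?N * (L * d) * d + ((lam - (1 - \<epsilon>) * \<gamma>) * d + (\<epsilon> * \<gamma> * d + L / 2 * d\<^sup>2))"
    proof (intro order_trans[OF norm_triangle_ineq] add_mono)
      have "norm (spec_reg lam H *v v - spec_reg lam Hs *v v) \<le> sqrt ?N * spec_norm (H - Hs) * d"
        using spec_reg_lipschitz[OF symH symHs, of lam v] by (simp add: dv)
      also have "\<dots> \<le> sqrt ?N * (L * d) * d"
        using HHs by (intro mult_right_mono mult_left_mono) (simp_all add: d_def)
      finally show "norm (spec_reg lam H *v v - spec_reg lam Hs *v v) \<le> sqrt ?N * (L * d) * d" .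
      show "norm (spec_reg lam Hs *v v - Hs *v v) \<le> (lam - (1 - \<epsilon>) * \<gamma>) * d"
        using spec_reg_diff[OF symHs lower, of lam v] lam_ge by (simp add: dv \<gamma>_def)
      show "norm (Hs *v v - A xstar *v v) \<le> \<epsilon> * \<gamma> * d" using dev[of v] by (simp add: dv)
      show "norm (A xstar *v v - (gradF xk - gradF xstar)) \<le> L / 2 * d\<^sup>2"
        using lin by (simp add: v_def norm_minus_commute)
    qed
    also have "\<dots> = lam * (((lam - (1 - \<epsilon>) * \<gamma> + \<gamma> * \<epsilon>) / lam) * d + ((sqrt ?N + 1 / 2) * L / lam) * d\<^sup>2)"
      using lam_pos by (simp add: power2_eq_square field_simps)
    finally show ?thesis by (rule mult_left_le_imp_le[OF _ lam_pos])
  qed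
  show ?thesis
  \<comment> \<open>The good event does not depend on \<open>y\<close>, so it serves all minimizers
    of the quadratic model at once.\<close>
  proof (rule prob_ge_on_support[OF bad], rule CollectI, intro allI impI, elim conjE)
    fix S y
    assume S: "S \<in> set_pmf (sample_pmf m n)" and good: "S \<notin> {S. t < spec_norm (\<Sum>j<m. g (S j))}"
      and y: "y \<in> D \<inter> X"
      and ymin: "\<forall>x\<in>D \<inter> X.
                       F xk + (y - xk) \<bullet> gradF xk
                         + (1 / (2 * 1)) * ((y - xk) \<bullet> (spec_reg lam (subH hess m S xk) *v (y - xk)))
                       \<le> F xk + (x - xk) \<bullet> gradF xk
                         + (1 / (2 * 1)) * ((x - xk) \<bullet> (spec_reg lam (subH hess m S xk) *v (x - xk)))"
    show "norm (y - xstar)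
                      \<le> ((lam - (1 - \<epsilon>) * \<gamma>star + \<gamma>star * \<epsilon>) / lam) * norm (xk - xstar)
                        + ((sqrt (real CARD('p)) + 1 / 2) * L / lam) * (norm (xk - xstar))\<^sup>2"
      unfolding \<gamma>_def[symmetric] d_def[symmetric]
    proof (rule main[of S])
      show "spec_norm (\<Sum>j<m. g (S j)) \<le> t" using good by simp
      show "y \<in> C" using y by (simp add: C_def)
      fix x assume "x \<in> C"
      then show "(y - xk) \<bullet> gradF xk + (1 / 2) * ((y - xk) \<bullet> (spec_reg lam (subH hess m S xk) *v (y - xk)))
        \<le> (x - xk) \<bullet> gradF xk + (1 / 2) * ((x - xk) \<bullet> (spec_reg lam (subH hess m S xk) *v (x - xk)))"
        using ymin by (simp add: C_def)
    qed (rule supp[OF S])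
  qed
qed

end
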